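(* Let $\varepsilon > 0$ be fixed. For all real $x \geq 1$ and all integers $q \geq 1$ with $x^{1/4} \leq q \leq x^{1/3}$, we have $$\frac{1}{\varphi(q)} \# \left\{ a \in (\mathbb{Z}/q\mathbb{Z})^{\times} : |E(x;q,a)| > x^{1/4 + \varepsilon} q^{1/4} \right\} \ll \frac{x^{1/2 - \varepsilon}}{q^2}.$$
   Context: For real $x \geq 1$, an integer $q \geq 1$ with $q \leq x$, and $a \in (\mathbb{Z}/q\mathbb{Z})^{\times}$, let $$S(x;q,a) = \sum_{\substack{1 \leq n \leq x \\ n \equiv a \ (\mathrm{mod}\ q)}} |\mu(n)|,$$ where $\mu$ is the Möbius function, and define $E(x;q,a)$ by $$S(x;q,a) = c_q \frac{x}{q} + E(x;q,a), \qquad c_q = \prod_{p \nmid q} \left( 1 - \frac{1}{p^2} \right),$$ the product being over primes $p$ not dividing $q$. $\varphi$ is Euler's totient function. The notation $A \ll B$ means that $|A| \leq C B$ for some constant $C > 0$ depending only on $\varepsilon$ (in particular, independent of $x$ and $q$). *)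

theory Defs
  imports
    "HOL-Analysis.Analysis"
    "HOL-Computational_Algebra.Computational_Algebra"
    "HOL-Number_Theory.Number_Theory"
begin

definition moebius_mu :: "nat \<Rightarrow> int" where
  "moebius_mu n = (if squarefree n then (-1) ^ card (prime_factors n) else 0)"

(* The residue class a is given by any representative in nat. *)
definition sqf_sum :: "real \<Rightarrow> nat \<Rightarrow> nat \<Rightarrow> real" where
  "sqf_sum x q a = (\<Sum>n | 1 \<le> n \<and> real n \<le> x \<and> [n = a] (mod q). real_of_int \<bar>moebius_mu n\<bar>)"

definition sqf_density :: "nat \<Rightarrow> real" where
  "sqf_density q = (\<Prod>p. if prime p \<and> \<not> p dvd q then 1 - 1 / real p ^ 2 else 1)"

(* prodinf is a definite description, meaningful only for a convergent product. *)
lemma convergent_prod_sqf_density: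
  "convergent_prod (\<lambda>p. if prime p \<and> \<not> p dvd q then 1 - 1 / real p ^ 2 else 1)"
proof (rule abs_convergent_prod_imp_convergent_prod, rule summable_imp_abs_convergent_prod)
  have "summable (\<lambda>p. 1 / real p ^ 2)"
    using inverse_power_summable[of 2, where ?'a = real] by (simp add: field_simps)
  then show "summable (\<lambda>p. norm ((if prime p \<and> \<not> p dvd q then 1 - 1 / real p ^ 2 else 1) - 1))"
    by (rule summable_comparison_test') auto
qed

definition sqf_error :: "real \<Rightarrow> nat \<Rightarrow> nat \<Rightarrow> real" where
  "sqf_error x q a = sqf_sum x q a - sqf_density q * (x / real q)"

end

theory Submission
  imports Defs
begin

text \<open>
  Opening \<open>|\<mu>(n)|\<close> as the sum of \<open>\<mu>(d)\<close> over \<open>d\<^sup>2 dvd n\<close> turns \<open>E(x;q,a)\<close> into a sum over \<open>d \<le> \<surd>x\<close>, cut at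
  \<open>D = \<surd>x / q powr (1/4)\<close>. For \<open>d > D\<close> the cofactor \<open>m = n/d\<^sup>2\<close> is less than \<open>\<surd>q\<close>, and counting the \<open>d\<close>
  with \<open>d\<^sup>2 \<equiv> a/m\<close> gives \<open>\<tau>(q) \<surd>x q powr (-3/4)\<close> for every \<open>a\<close>. For \<open>d \<le> D\<close> the error is expanded
  in additive characters modulo \<open>q\<close>; by Parseval its second moment over \<open>a\<close> is \<open>1/q\<close> times the sum of
  the squares of exponential sums \<open>T(h)\<close>, \<open>0 < h < q\<close>. Geometric series bound \<open>T(h)\<close> by a sum of
  \<open>1 / \<parallel>h d\<^sup>2 / q\<parallel>\<close> over \<open>d \<le> D\<close>, and the trivial estimate \<open>max T * \<Sum> T\<close> suffices because squares
  coprime to \<open>q\<close> represent each class at most \<open>2 \<tau>(q)\<close> times. Hence the second moment of \<open>E\<close>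
  is at most \<open>x powr (1 + o(1)) / \<surd>q\<close>, and Chebyshev's inequality concludes.
\<close>

subsection \<open>The Moebius function and the density of squarefree numbers\<close>

lemma squarefree_nat_gt_0: "squarefree d \<Longrightarrow> d > 0" for d :: nat
  by (cases "d = 0") auto

lemma prod_prime_factors_squarefree:
  fixes d :: nat
  assumes "squarefree d"
  shows "\<Prod>(prime_factors d) = d"
proof -
  have d: "d \<noteq> 0" using squarefree_nat_gt_0[OF assms] by simp
  have "d = (\<Prod>p\<in>prime_factors d. p ^ multiplicity p d)"
    using d by (simp add: prime_factorization_nat)
  also have "\<dots> = \<Prod>(prime_factors d)"
  proof (rule prod.cong)
    fix p assume p: "p \<in> prime_factors d"
    then have "multiplicity p d > 0" "multiplicity p d \<le> 1"
      using assms d by (auto simp: squarefree_factorial_semiring'' prime_factors_multiplicity)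
    then have "multiplicity p d = 1" by linarith
    then show "p ^ multiplicity p d = p" by simp
  qed simp
  finally show ?thesis by simp
qed

text \<open>A squarefree number with all prime factors in \<open>P\<close> is the product of a
  unique subset of \<open>P\<close>, and the sign of that subset is its Moebius value. This turns
  products over primes, expanded by subsets, into Moebius sums.\<close>

lemma sum_squarefree_reindex:
  fixes f :: "nat \<Rightarrow> real"
  assumes "finite P" and P: "\<And>p. p \<in> P \<Longrightarrow> prime p"
  shows "(\<Sum>A\<in>Pow P. (-1) ^ card A * f (\<Prod>A)) =
         (\<Sum>d | squarefree d \<and> prime_factors d \<subseteq> P. of_int (moebius_mu d) * f d)"
proof (rule sum.reindex_bij_witness[where i = prime_factors and j = "\<lambda>A. \<Prod>A"])
  fix A assume A: "A \<in> Pow P"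
  then have fin: "finite A" and pr: "\<And>p. p \<in> A \<Longrightarrow> prime p"
    using assms finite_subset by blast+
  have pf: "prime_factors (\<Prod>A) = A"
  proof -
    have "prime_factors (\<Prod>A) = \<Union>((prime_factors \<circ> (\<lambda>x. x)) ` A)"
      using fin pr by (intro prime_factors_prod) (auto dest: prime_gt_0_nat)
    also have "\<dots> = A" using pr by (auto simp: prime_factorization_prime)
    finally show ?thesis .
  qed
  have sq: "squarefree (\<Prod>A)"
    using pr by (intro squarefree_prod_coprime) (auto simp: squarefree_prime primes_coprime)
  show "prime_factors (\<Prod>A) = A" by (rule pf)
  show "\<Prod>A \<in> {d. squarefree d \<and> prime_factors d \<subseteq> P}" using pf sq A by auto
  show "of_int (moebius_mu (\<Prod>A)) * f (\<Prod>A) = (-1) ^ card A * f (\<Prod>A)"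
    using pf sq by (simp add: moebius_mu_def)
next
  fix d assume d: "d \<in> {d. squarefree d \<and> prime_factors d \<subseteq> P}"
  then show "prime_factors d \<in> Pow P" by auto
  from d show "\<Prod>(prime_factors d) = d" by (simp add: prod_prime_factors_squarefree)
qed

lemma finite_squarefree_prime_factors_subset:
  assumes "finite P"
  shows "finite {d::nat. squarefree d \<and> prime_factors d \<subseteq> P}"
proof (rule finite_subset)
  show "{d. squarefree d \<and> prime_factors d \<subseteq> P} \<subseteq> (\<lambda>A. \<Prod>A) ` Pow P"
  proof
    fix d assume "d \<in> {d. squarefree d \<and> prime_factors d \<subseteq> P}"
    then have "d = \<Prod>(prime_factors d)" "prime_factors d \<in> Pow P"
      by (auto simp: prod_prime_factors_squarefree)
    then show "d \<in> (\<lambda>A. \<Prod>A) ` Pow P" by (rule image_eqI)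
  qed
  show "finite ((\<lambda>A. \<Prod>A) ` Pow P)" using assms by simp
qed

text \<open>Since \<open>d\<^sup>2 dvd n\<close> means that \<open>d\<close> divides
  \<open>s = square_part n\<close>, the sum runs over all divisors of \<open>s\<close>. Only
  squarefree ones count, and collecting them by sets of primes gives the product of
  \<open>1 - 1\<close> over the primes of \<open>s\<close>, which vanishes unless
  \<open>s = 1\<close>.\<close>

lemma sum_moebius_mu_square_dvd:
  assumes "n > 0"
  shows "(\<Sum>d | d\<^sup>2 dvd n. moebius_mu d) = \<bar>moebius_mu n\<bar>"
proof -
  define s where "s = square_part n"
  have s0: "s \<noteq> 0" using assms by (simp add: s_def)
  define P where "P = prime_factors s"
  have fP: "finite P" by (simp add: P_def)
  have "real_of_int (\<Sum>d | d\<^sup>2 dvd n. moebius_mu d) = (\<Sum>d | d dvd s. of_int (moebius_mu d) * 1)"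
    by (simp add: s_def dvd_square_part_iff)
  also have "\<dots> = (\<Sum>d | squarefree d \<and> prime_factors d \<subseteq> P. of_int (moebius_mu d) * 1)"
  proof (rule sum.mono_neutral_right)
    show "finite {d. d dvd s}" using s0 by simp
    show "{d. squarefree d \<and> prime_factors d \<subseteq> P} \<subseteq> {d. d dvd s}"
    proof safe
      fix d assume d: "squarefree d" "prime_factors d \<subseteq> P"
      show "d dvd s"
      proof (rule multiplicity_le_imp_dvd)
        show d0: "d \<noteq> 0" using squarefree_nat_gt_0[OF d(1)] by simp
        fix p :: nat assume p: "prime p"
        show "multiplicity p d \<le> multiplicity p s"
        proof (cases "p \<in> prime_factors d")
          case True
          then have "multiplicity p d \<le> 1" using d
            by (auto simp: squarefree_factorial_semiring'' d0)
          moreover have "p \<in> prime_factors s" using True d P_def by auto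
          then have "multiplicity p s > 0" by (simp add: prime_factors_multiplicity)
          ultimately show ?thesis by linarith
        next
          case False
          then have "multiplicity p d = 0" using p by (simp add: prime_factors_multiplicity)
          then show ?thesis by simp
        qed
      qed
    qed
    show "\<forall>i\<in>{d. d dvd s} - {d. squarefree d \<and> prime_factors d \<subseteq> P}. real_of_int (moebius_mu i) * 1 = 0"
    proof
      fix d assume "d \<in> {d. d dvd s} - {d. squarefree d \<and> prime_factors d \<subseteq> P}"
      then have "d dvd s" and nd: "\<not> (squarefree d \<and> prime_factors d \<subseteq> P)" by auto
      then have "prime_factors d \<subseteq> P" unfolding P_def using s0 by (simp add: dvd_prime_factors)
      then have "\<not> squarefree d" using nd by blast
      then show "real_of_int (moebius_mu d) * 1 = 0" by (simp add: moebius_mu_def)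
    qed
  qed
  also have "\<dots> = (\<Sum>A\<in>Pow P. (-1) ^ card A * 1)"
    by (rule sum_squarefree_reindex[symmetric]) (auto simp: P_def)
  also have "\<dots> = (\<Prod>p\<in>P. 1 - 1)"
    by (subst prod_diff_conv_sum[OF fP]) simp
  also have "\<dots> = (if P = {} then 1 else 0)" using fP by (auto simp: card_gt_0_iff)
  also have "P = {} \<longleftrightarrow> s = 1" using s0 by (auto simp: P_def prime_factorization_empty_iff)
  also have "s = 1 \<longleftrightarrow> squarefree n"
  proof
    assume s1: "s = 1"
    show "squarefree n"
      using s1 unfolding s_def by (metis dvd_square_part_iff squarefreeI)
  next
    assume "squarefree n"
    then have "s dvd 1" using square_part_square_dvd[of n] squarefreeD s_def by blast
    then show "s = 1" by simp
  qed
  also have "(if squarefree n then 1 else 0) = real_of_int \<bar>moebius_mu n\<bar>"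
    by (simp add: moebius_mu_def power_abs)
  finally show ?thesis by (simp only: of_int_eq_iff)
qed

section \<open>Truncating the Euler product of the density\<close>

lemma abs_moebius_mu_le: "\<bar>real_of_int (moebius_mu n)\<bar> \<le> 1"
  by (simp add: moebius_mu_def power_abs)

lemma sum_inverse_squares_tail:
  fixes N M :: nat
  assumes "N > 0"
  shows "(\<Sum>d\<in>{N<..M}. 1 / real d ^ 2) \<le> 1 / N"
proof (cases "N \<le> M")
  case True
  \<comment> \<open>The extra term \<open>- 1 / M\<close> lets the induction telescope.\<close>
  have "(\<Sum>d\<in>{N<..M}. 1 / real d ^ 2) \<le> 1 / N - 1 / M"
    using True
  proof (induction M rule: dec_induct)
    case (step m)
    have "{N<..Suc m} = insert (Suc m) {N<..m}" using step by auto
    then have "(\<Sum>d\<in>{N<..Suc m}. 1 / real d ^ 2) = 1 / real (Suc m) ^ 2 + (\<Sum>d\<in>{N<..m}. 1 / real d ^ 2)"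
      by simp
    also have "\<dots> \<le> 1 / real (Suc m) ^ 2 + (1 / N - 1 / m)" using step by simp
    also have "1 / real (Suc m) ^ 2 \<le> 1 / m - 1 / Suc m"
      using step assms by (simp add: divide_simps power2_eq_square)
    finally show ?case by simp
  qed simp
  also have "\<dots> \<le> 1 / N" by simp
  finally show ?thesis .
qed simp

text \<open>A finite Euler product over the primes up to \<open>M\<close> is a finite Moebius sum
  over the squarefree integers built from them. For \<open>M \<ge> N\<close> its terms with
  \<open>d \<le> N\<close> are exactly the truncated sum, and the others are dominated by the tail
  of \<open>1 / d\<^sup>2\<close>. The bound is uniform in \<open>M\<close>, so it survives the
  limit.\<close>

lemma sqf_density_approx:
  fixes N q :: nat
  assumes "N > 0" "q > 0"
  shows "\<bar>sqf_density q - (\<Sum>d | d \<in> {1..N} \<and> coprime d q. of_int (moebius_mu d) / real d ^ 2)\<bar> \<le> 1 / N"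
proof -
  define f where "f = (\<lambda>p. if prime p \<and> \<not> p dvd q then 1 - 1 / real p ^ 2 else 1)"
  define S where "S = (\<Sum>d | d \<in> {1..N} \<and> coprime d q. of_int (moebius_mu d) / real d ^ 2)"
  have "f has_prod sqf_density q"
    using convergent_prod_has_prod[OF convergent_prod_sqf_density[of q]]
    by (simp add: f_def sqf_density_def)
  then have lim: "(\<lambda>n. \<Prod>k\<le>n. f k) \<longlonglongrightarrow> sqf_density q" by (rule has_prod_imp_tendsto)
  have bd: "\<bar>(\<Prod>k\<le>M. f k) - S\<bar> \<le> 1 / N" if "M \<ge> N" for M
  proof -
    define P where "P = {p. p \<le> M \<and> prime p \<and> \<not> p dvd q}"
    have fP: "finite P" by (simp add: P_def)
    define T where "T = {d::nat. squarefree d \<and> prime_factors d \<subseteq> P}"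
    have fT: "finite T" unfolding T_def by (rule finite_squarefree_prime_factors_subset[OF fP])
    have "(\<Prod>k\<le>M. f k) = (\<Prod>k\<in>P. 1 - 1 / real k ^ 2)"
      unfolding f_def P_def by (rule prod.mono_neutral_cong_right) auto
    also have "\<dots> = (\<Sum>A\<in>Pow P. (-1) ^ card A * (1 / real (\<Prod>A) ^ 2))"
      by (subst prod_diff_conv_sum[OF fP]) (simp add: prod_dividef prod_power_distrib)
    also have "\<dots> = (\<Sum>d\<in>T. of_int (moebius_mu d) * (1 / real d ^ 2))"
      unfolding T_def by (rule sum_squarefree_reindex[OF fP]) (auto simp: P_def)
    finally have 1: "(\<Prod>k\<le>M. f k) = (\<Sum>d\<in>T. of_int (moebius_mu d) * (1 / real d ^ 2))" .
    have Tin: "{d\<in>T. d \<le> N} = {d. d \<in> {1..N} \<and> coprime d q \<and> squarefree d}"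
    proof safe
      fix d assume d: "d \<in> T" "d \<le> N"
      then show "d \<in> {1..N}" by (cases "d = 0") (auto simp: T_def)
      show "squarefree d" using d by (auto simp: T_def)
      show "coprime d q"
      proof (rule ccontr)
        assume "\<not> coprime d q"
        then obtain p where p: "prime p" "p dvd d" "p dvd q"
          by (metis coprime_iff_gcd_eq_1 gcd_dvd1 gcd_dvd2 dvd_trans prime_factor_nat)
        moreover have "d > 0" using d by (auto simp: T_def squarefree_nat_gt_0)
        ultimately have "p \<in> prime_factors d" by (auto simp: in_prime_factors_iff)
        then show False using d p(3) by (auto simp: T_def P_def)
      qed
    next
      fix d assume d: "d \<in> {1..N}" "coprime d q" "squarefree d"
      show "d \<in> T" unfolding T_def P_def
      proof safe
        fix p assume p: "p \<in># prime_factorization d"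
        then have "p dvd d" "prime p" by auto
        then have "p \<le> d" using d by (auto intro: dvd_imp_le)
        then show "p \<le> M" using d that by simp
        show "prime p" by fact
        assume "p dvd q"
        then show False using d \<open>p dvd d\<close> \<open>prime p\<close>
          by (meson coprime_common_divisor not_prime_unit)
      qed (use d in auto)
    qed auto
    have "S = (\<Sum>d\<in>{d\<in>T. d \<le> N}. of_int (moebius_mu d) * (1 / real d ^ 2))"
      unfolding S_def Tin
      by (rule sum.mono_neutral_cong_right) (auto simp: moebius_mu_def)
    moreover have "(\<Sum>d\<in>T. of_int (moebius_mu d) * (1 / real d ^ 2))
        = (\<Sum>d\<in>{d\<in>T. d \<le> N}. of_int (moebius_mu d) * (1 / real d ^ 2))
          + (\<Sum>d\<in>{d\<in>T. d > N}. of_int (moebius_mu d) * (1 / real d ^ 2))"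
      by (subst sum.union_disjoint[symmetric]) (auto simp: fT intro!: sum.cong)
    ultimately have "\<bar>(\<Prod>k\<le>M. f k) - S\<bar> = \<bar>\<Sum>d\<in>{d\<in>T. d > N}. of_int (moebius_mu d) * (1 / real d ^ 2)\<bar>"
      using 1 by simp
    also have "\<dots> \<le> (\<Sum>d\<in>{d\<in>T. d > N}. 1 / real d ^ 2)"
      by (rule order_trans[OF sum_abs], rule sum_mono)
         (use abs_moebius_mu_le in \<open>auto simp: abs_mult divide_right_mono\<close>)
    also have "\<dots> \<le> (\<Sum>d\<in>{N<..Max (insert 0 T)}. 1 / real d ^ 2)"
      by (rule sum_mono2) (use fT in auto)
    also have "\<dots> \<le> 1 / N" by (rule sum_inverse_squares_tail[OF assms(1)])
    finally show ?thesis .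
  qed
  have lim2: "(\<lambda>n. \<bar>(\<Prod>k\<le>n. f k) - S\<bar>) \<longlonglongrightarrow> \<bar>sqf_density q - S\<bar>"
    by (intro tendsto_intros lim)
  have "\<bar>sqf_density q - S\<bar> \<le> 1 / N"
    by (rule LIMSEQ_le_const2[OF lim2]) (use bd in blast)
  then show ?thesis by (simp add: S_def)
qed

text \<open>The sums over \<open>n\<close> and over \<open>d\<close> with
  \<open>d\<^sup>2 dvd n\<close> are interchanged, and \<open>n\<close> is written as
  \<open>m * d\<^sup>2\<close>. Every \<open>n\<close> in the class of \<open>a\<close> is coprime
  to \<open>q\<close>, so only \<open>d\<close> coprime to \<open>q\<close> contribute. The range
  \<open>K\<close> only has to reach all possible \<open>d\<close>, which satisfy
  \<open>d \<le> n \<le> x\<close>.\<close>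

lemma sqf_sum_conv_moebius:
  assumes "x \<ge> 0" "q > 0" "coprime a q" "nat \<lfloor>x\<rfloor> \<le> K"
  shows "sqf_sum x q a = (\<Sum>d | d \<in> {1..K} \<and> coprime d q. of_int (moebius_mu d) *
           real (card {m. 1 \<le> m \<and> real (m * d\<^sup>2) \<le> x \<and> [m * d\<^sup>2 = a] (mod q)}))"
proof -
  define I where "I = {n. 1 \<le> n \<and> real n \<le> x \<and> [n = a] (mod q)}"
  have IK: "I \<subseteq> {1..K}"
  proof
    fix n assume "n \<in> I"
    then have "1 \<le> n" "n \<le> nat \<lfloor>x\<rfloor>" by (auto simp: I_def le_nat_floor)
    then show "n \<in> {1..K}" using assms by auto
  qed
  then have fI: "finite I" using finite_subset by blast
  have "sqf_sum x q a = (\<Sum>n\<in>I. \<Sum>d | d\<^sup>2 dvd n. real_of_int (moebius_mu d))"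
    unfolding sqf_sum_def I_def[symmetric]
  proof (rule sum.cong)
    fix n assume "n \<in> I"
    then have "n > 0" by (auto simp: I_def)
    from sum_moebius_mu_square_dvd[OF this]
    show "real_of_int \<bar>moebius_mu n\<bar> = (\<Sum>d | d\<^sup>2 dvd n. real_of_int (moebius_mu d))"
      by (metis of_int_sum)
  qed simp
  also have "\<dots> = (\<Sum>n\<in>I. \<Sum>d\<in>{1..K}. if d\<^sup>2 dvd n then real_of_int (moebius_mu d) else 0)"
  proof (rule sum.cong)
    fix n assume n: "n \<in> I"
    then have n0: "n > 0" by (auto simp: I_def)
    have "{d. d\<^sup>2 dvd n} = {d\<in>{1..K}. d\<^sup>2 dvd n}"
    proof safe
      fix d assume d: "d\<^sup>2 dvd n"
      then have "d > 0" using n0 by (cases "d = 0") auto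
      moreover have "d \<le> d\<^sup>2" by (simp add: power2_eq_square)
      moreover have "d\<^sup>2 \<le> n" using d n0 by (simp add: dvd_imp_le)
      moreover have "n \<le> K" using n IK by auto
      ultimately show "d \<in> {1..K}" by simp
    qed
    then show "(\<Sum>d | d\<^sup>2 dvd n. real_of_int (moebius_mu d)) = (\<Sum>d\<in>{1..K}. if d\<^sup>2 dvd n then real_of_int (moebius_mu d) else 0)"
      by (simp only: sum.inter_filter[OF finite_atLeastAtMost])
  qed simp
  also have "\<dots> = (\<Sum>d\<in>{1..K}. \<Sum>n\<in>I. if d\<^sup>2 dvd n then real_of_int (moebius_mu d) else 0)"
    by (rule sum.swap)
  also have "\<dots> = (\<Sum>d\<in>{1..K}. of_int (moebius_mu d) * real (card {n\<in>I. d\<^sup>2 dvd n}))"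
    by (simp add: sum.inter_filter[symmetric] fI mult.commute)
  also have "\<dots> = (\<Sum>d | d \<in> {1..K} \<and> coprime d q. of_int (moebius_mu d) * real (card {n\<in>I. d\<^sup>2 dvd n}))"
  proof (rule sum.mono_neutral_right)
    show "\<forall>d\<in>{1..K} - {d. d \<in> {1..K} \<and> coprime d q}. of_int (moebius_mu d) * real (card {n\<in>I. d\<^sup>2 dvd n}) = 0"
    proof
      fix d assume d: "d \<in> {1..K} - {d. d \<in> {1..K} \<and> coprime d q}"
      have "{n\<in>I. d\<^sup>2 dvd n} = {}"
      proof (rule ccontr)
        assume "{n\<in>I. d\<^sup>2 dvd n} \<noteq> {}"
        then obtain n where n: "[n = a] (mod q)" "d\<^sup>2 dvd n" by (auto simp: I_def)
        have "coprime n q" using n assms(3) by (metis cong_imp_coprime cong_sym)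
        then have "coprime (d\<^sup>2) q" using coprime_divisors[OF n(2) dvd_refl] by simp
        then show False using d by auto
      qed
      then show "of_int (moebius_mu d) * real (card {n\<in>I. d\<^sup>2 dvd n}) = 0"
        by (simp only: card.empty of_nat_0 mult_zero_right)
    qed
  qed auto
  also have "\<dots> = (\<Sum>d | d \<in> {1..K} \<and> coprime d q. of_int (moebius_mu d) *
           real (card {m. 1 \<le> m \<and> real (m * d\<^sup>2) \<le> x \<and> [m * d\<^sup>2 = a] (mod q)}))"
  proof (rule sum.cong)
    fix d assume d: "d \<in> {d. d \<in> {1..K} \<and> coprime d q}"
    have "bij_betw (\<lambda>m. m * d\<^sup>2) {m. 1 \<le> m \<and> real (m * d\<^sup>2) \<le> x \<and> [m * d\<^sup>2 = a] (mod q)} {n\<in>I. d\<^sup>2 dvd n}"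
      by (rule bij_betw_byWitness[where f' = "\<lambda>n. n div d\<^sup>2"]) (use d in \<open>auto simp: I_def mult.commute elim!: dvdE\<close>)
    then show "of_int (moebius_mu d) * real (card {n\<in>I. d\<^sup>2 dvd n}) = of_int (moebius_mu d) *
           real (card {m. 1 \<le> m \<and> real (m * d\<^sup>2) \<le> x \<and> [m * d\<^sup>2 = a] (mod q)})"
      by (simp add: bij_betw_same_card)
  qed simp
  finally show ?thesis .
qed

subsection \<open>Divisors and square roots modulo \<open>q\<close>\<close>

text \<open>This will bound one fibre of the count of square roots, whose members agree modulo
  \<open>q\<close> only after doubling. Shifted by the minimum they satisfy
  \<open>q dvd 2 * d\<close>, and then the quotient \<open>2 * d div q\<close> determines
  \<open>d\<close>.\<close>

lemma card_le_of_cong_double: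
  fixes A :: "nat set" and q N :: nat
  assumes "q > 0" "A \<subseteq> {1..N}"
    and cong: "\<And>d d'. d \<in> A \<Longrightarrow> d' \<in> A \<Longrightarrow> int q dvd 2 * (int d - int d')"
  shows "real (card A) \<le> 2 * real N / real q + 1"
proof (cases "A = {}")
  case False
  have fA: "finite A" using assms finite_subset by blast
  define m where "m = Min A"
  have m: "m \<in> A" "\<And>d. d \<in> A \<Longrightarrow> m \<le> d" using fA False by (auto simp: m_def)
  have "A \<subseteq> (\<lambda>d. d + m) ` {d. d \<le> N \<and> q dvd 2 * d}"
  proof
    fix d assume d: "d \<in> A"
    have "int q dvd int (2 * (d - m))"
      using cong[OF d m(1)] m(2)[OF d] by (simp add: of_nat_diff)
    then have "q dvd 2 * (d - m)" using int_dvd_int_iff by blast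
    moreover have "d - m \<le> N" using d assms(2) by fastforce
    ultimately show "d \<in> (\<lambda>d. d + m) ` {d. d \<le> N \<and> q dvd 2 * d}"
      using m(2)[OF d] by (intro image_eqI[where x = "d - m"]) auto
  qed
  then have "card A \<le> card {d. d \<le> N \<and> q dvd 2 * d}"
    by (intro surj_card_le) auto
  also have "\<dots> \<le> card {0..2 * N div q}"
  proof (rule card_inj_on_le[where f = "\<lambda>d. 2 * d div q"])
    show "inj_on (\<lambda>d. 2 * d div q) {d. d \<le> N \<and> q dvd 2 * d}"
    proof (rule inj_onI)
      fix d d' assume *: "d \<in> {d. d \<le> N \<and> q dvd 2 * d}" "d' \<in> {d. d \<le> N \<and> q dvd 2 * d}"
        and "2 * d div q = 2 * d' div q"
      then have "2 * d div q * q = 2 * d' div q * q" by simp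
      moreover have "2 * d div q * q = 2 * d" "2 * d' div q * q = 2 * d'"
        using * by (metis dvd_div_mult_self mem_Collect_eq)+
      ultimately show "d = d'" by linarith
    qed
    show "(\<lambda>d. 2 * d div q) ` {d. d \<le> N \<and> q dvd 2 * d} \<subseteq> {0..2 * N div q}"
      by (auto intro!: div_le_mono)
  qed auto
  also have "\<dots> = 2 * N div q + 1" by simp
  finally have "real (card A) \<le> real (2 * N div q) + 1" by linarith
  also have "real (2 * N div q) \<le> real (2 * N) / real q" by (rule of_nat_div_le_of_nat)
  finally show ?thesis by simp
qed simp

text \<open>
  Fix one solution \<open>s\<close>. Since \<open>q\<close> divides \<open>(d - s) (d + s)\<close>, any other solution \<open>d\<close> is congruent to \<open>s\<close>
  modulo \<open>u = gcd (d - s) q\<close> and to \<open>-s\<close> modulo \<open>q / u\<close>. As \<open>gcd u (q / u)\<close> divides \<open>2\<close>, the divisor \<open>u\<close>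
  determines \<open>d\<close> up to multiples of \<open>q / 2\<close>.
\<close>
lemma square_root_count:
  fixes q h k N :: nat
  assumes "q > 0" "coprime h q"
  shows "real (card {d\<in>{1..N}. coprime d q \<and> [h * d\<^sup>2 = k] (mod q)})
         \<le> real (card {u. u dvd q}) * (2 * real N / real q + 1)"
proof -
  define A where "A = {d\<in>{1..N}. coprime d q \<and> [h * d\<^sup>2 = k] (mod q)}"
  have fA: "finite A" by (simp add: A_def)
  show ?thesis
  proof (cases "A = {}")
    case True
    then show ?thesis unfolding A_def[symmetric] by simp
  next
    case False
    then obtain s where s: "s \<in> A" by blast
    define g where "g = (\<lambda>d. nat (gcd (int d - int s) (int q)))"
    have gd: "g d dvd q" for d
    proof -
      have "int (g d) dvd int q" by (simp add: g_def)
      then show ?thesis using int_dvd_int_iff by blast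
    qed
    have fibre: "real (card {d\<in>A. g d = u}) \<le> 2 * real N / real q + 1" if u: "u dvd q" for u
    proof (rule card_le_of_cong_double[OF assms(1)])
      show "{d\<in>A. g d = u} \<subseteq> {1..N}" by (auto simp: A_def)
      obtain v where v: "q = u * v" using u by (elim dvdE)
      have u0: "u > 0" and v0: "v > 0" using v assms by auto
      have *: "int u dvd int d - int s \<and> int v dvd int d + int s" if d: "d \<in> A" "g d = u" for d
      proof -
        have gu: "gcd (int d - int s) (int q) = int u"
          unfolding d(2)[symmetric] g_def by simp
        have "[h * d\<^sup>2 = h * s\<^sup>2] (mod q)"
          using d s unfolding A_def by (auto intro: cong_trans cong_sym)
        then have "[d\<^sup>2 = s\<^sup>2] (mod q)" using assms by (simp add: cong_mult_lcancel_nat)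
        then have "[int (d\<^sup>2) = int (s\<^sup>2)] (mod int q)" using cong_int_iff by blast
        then have "int q dvd (int d - int s) * (int d + int s)"
          by (simp add: cong_iff_dvd_diff power2_eq_square algebra_simps)
        \<comment> \<open>Because \<open>u\<close> is the exact gcd, the cofactor \<open>w\<close>
          is coprime to \<open>v\<close>, so \<open>v\<close> must divide the other factor
          \<open>d + s\<close>.\<close>
        obtain w where w: "int d - int s = int u * w" using gu by (metis dvdE gcd_dvd1)
        have "gcd (int u * w) (int u * int v) = int u" using gu w v by simp
        then have "int u * gcd w (int v) = int u" by (simp add: gcd_mult_distrib_int[symmetric] flip: gcd_mult_distrib_int)
        then have "coprime w (int v)" using u0 by (simp add: coprime_iff_gcd_eq_1)
        have "int u * int v dvd int u * (w * (int d + int s))"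
          using \<open>int q dvd _\<close> w v by (simp add: mult.assoc)
        then have "int v dvd w * (int d + int s)" using u0 by simp
        then have "int v dvd int d + int s" using \<open>coprime w (int v)\<close>
          by (metis coprime_commute coprime_dvd_mult_right_iff)
        then show ?thesis using w by simp
      qed
      have cop: "coprime s q" using s by (simp add: A_def)
      fix d d' assume d: "d \<in> {d\<in>A. g d = u}" and d': "d' \<in> {d\<in>A. g d = u}"
      let ?t = "int d - int d'"
      let ?g = "gcd (int u) (int v)"
      \<comment> \<open>A common divisor of \<open>u\<close> and \<open>v\<close> divides
        \<open>2 * s\<close>. As \<open>s\<close> is coprime to \<open>q\<close>, it divides
        \<open>2\<close>; this is the only loss in passing from the lcm of \<open>u\<close> and
        \<open>v\<close> to \<open>q = u * v\<close>.\<close>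
      have "?g dvd (int d + int s) - (int d - int s)"
        using *[of d] d by (blast intro: dvd_diff dvd_trans[OF gcd_dvd1] dvd_trans[OF gcd_dvd2])
      then have "?g dvd 2 * int s" by simp
      moreover have "coprime ?g (int s)"
        by (rule coprime_divisors[of _ "int q" _ "int s"])
           (use cop v in \<open>auto simp: coprime_commute\<close>)
      ultimately have guv: "?g dvd 2" by (metis coprime_dvd_mult_left_iff)
      have 1: "int u dvd ?t"
      proof -
        have "int u dvd (int d - int s) - (int d' - int s)"
          by (rule dvd_diff) (use * d d' in auto)
        then show ?thesis by simp
      qed
      have 2: "int v dvd ?t"
      proof -
        have "int v dvd (int d + int s) - (int d' + int s)"
          by (rule dvd_diff) (use * d d' in auto)
        then show ?thesis by simp
      qed
      have "lcm (int u) (int v) dvd ?t" using 1 2 by (rule lcm_least)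
      then have "gcd (int u) (int v) * lcm (int u) (int v) dvd 2 * ?t"
        using guv by (rule_tac mult_dvd_mono)
      moreover have "gcd (int u) (int v) * lcm (int u) (int v) = int q"
        using prod_gcd_lcm_nat[of u v] v by (simp flip: of_nat_mult)
      ultimately show "int q dvd 2 * ?t" by simp
    qed
    have "A = (\<Union>u\<in>{u. u dvd q}. {d\<in>A. g d = u})" using gd by auto
    then have "card A \<le> (\<Sum>u | u dvd q. card {d\<in>A. g d = u})"
      using card_UN_le[of "{u. u dvd q}" "\<lambda>u. {d\<in>A. g d = u}"] assms by simp
    then have "real (card A) \<le> (\<Sum>u | u dvd q. real (card {d\<in>A. g d = u}))"
      by (metis of_nat_le_iff of_nat_sum)
    also have "\<dots> \<le> (\<Sum>u | u dvd q. 2 * real N / real q + 1)"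
      by (rule sum_mono) (use fibre in auto)
    finally show ?thesis unfolding A_def[symmetric] by simp
  qed
qed

section \<open>Totients and the divisor bound\<close>

lemma le_divisors_totient:
  "n \<le> card {d. d dvd n} * totient n" if "n > 0" for n :: nat
proof -
  have "n = (\<Sum>d | d dvd n. totient d)" by (simp add: totient_divisor_sum)
  \<comment> \<open>This is a crude bound for \<open>n / totient n\<close>, but a divisor count
    costs only a small power of \<open>n\<close>.\<close>
  also have "\<dots> \<le> (\<Sum>d | d dvd n. totient n)"
    by (rule sum_mono) (use that totient_dvd_mono in auto)
  finally show ?thesis by simp
qed

lemma card_divisors_mono:
  "card {d. d dvd m} \<le> card {d. d dvd n}" if "m dvd n" "n > 0" for m n :: nat
  by (rule card_mono) (use that dvd_trans in auto)

lemma card_divisors_ge_1: "card {d. d dvd n} \<ge> 1" if "n > 0" for n :: nat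
  using card_mono[of "{d. d dvd n}" "{1}"] that by simp

text \<open>Every divisor has the form \<open>p ^ i * e\<close> with \<open>i \<le> a\<close> and
  \<open>e dvd m\<close>, so counting the pairs suffices.\<close>

lemma card_divisors_prime_power_mult:
  fixes p m :: nat
  assumes "prime p" "m > 0"
  shows "card {d. d dvd p ^ a * m} \<le> (a + 1) * card {d. d dvd m}"
proof -
  have "{d. d dvd p ^ a * m} \<subseteq> (\<lambda>(i, e). p ^ i * e) ` ({..a} \<times> {d. d dvd m})"
  proof
    fix d assume "d \<in> {d. d dvd p ^ a * m}"
    then obtain b c where "d = b * c" "b dvd p ^ a" "c dvd m"
      by (auto dest: division_decomp)
    moreover then obtain i where "i \<le> a" "b = p ^ i"
      using divides_primepow_nat[OF assms(1)] by blast
    ultimately show "d \<in> (\<lambda>(i, e). p ^ i * e) ` ({..a} \<times> {d. d dvd m})" by auto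
  qed
  then have "card {d. d dvd p ^ a * m} \<le> card ({..a} \<times> {d. d dvd m})"
    using assms by (intro surj_card_le) auto
  then show ?thesis by (simp add: card_cartesian_product)
qed

text \<open>
  A prime power \<open>p ^ a\<close> contributes the factor \<open>a + 1\<close>. It is at most \<open>p powr (\<delta> * a)\<close> as soon as
  \<open>p \<ge> B = 2 powr (1 / \<delta>)\<close>; each of the finitely many smaller primes costs a constant factor \<open>K\<close>.
\<close>
lemma divisor_bound:
  fixes \<delta> :: real
  assumes "\<delta> > 0"
  obtains C where "C > 0" "\<And>n. n > 0 \<Longrightarrow> real (card {d. d dvd n}) \<le> C * real n powr \<delta>"
proof -
  define B where "B = (2::real) powr (1 / \<delta>)"
  \<comment> \<open>For \<open>p \<ge> 2\<close> the inequality
    \<open>2 powr (\<delta> * a) \<ge> 1 + \<delta> * a * ln 2\<close> bounds \<open>a\<close> by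
    \<open>2 powr (\<delta> * a) / (\<delta> * ln 2)\<close>, which accounts for this
    constant.\<close>
  define K where "K = max 1 (1 / (\<delta> * ln 2) + 1)"
  have K: "K \<ge> 1" by (simp add: K_def)
  define Q where "Q = (\<lambda>n::nat. {p. prime p \<and> p dvd n \<and> real p < B})"
  have fQ: "finite (Q n)" if "n > 0" for n using that by (auto simp: Q_def)
  have pp: "real (a + 1) \<le> (if real p < B then K else 1) * real p powr (\<delta> * real a)"
    if p: "prime p" for p a :: nat
  proof -
    have p2: "real p \<ge> 2" using prime_ge_2_nat[OF p] by simp
    show ?thesis
    proof (cases "real p < B")
      case True
      have "K * real p powr (\<delta> * real a) \<ge> K * (2 powr (\<delta> * real a))"
        using K p2 assms by (intro mult_left_mono powr_mono2) auto
      moreover have "2 powr (\<delta> * real a) \<ge> 1 + \<delta> * real a * ln 2"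
        by (simp add: powr_def)
      moreover have "2 powr (\<delta> * real a) \<ge> 1" using assms by (simp add: ge_one_powr_ge_zero)
      moreover have "real (a + 1) \<le> (1 / (\<delta> * ln 2)) * (1 + \<delta> * real a * ln 2) + 1"
        using assms by (simp add: field_simps)
      ultimately have "real (a + 1) \<le> (1 / (\<delta> * ln 2) + 1) * 2 powr (\<delta> * real a)"
        using assms mult_left_mono[of "1 + \<delta> * real a * ln 2" "2 powr (\<delta> * real a)" "1 / (\<delta> * ln 2)"]
        by (simp add: distrib_right)
      also have "\<dots> \<le> K * 2 powr (\<delta> * real a)"
        by (rule mult_right_mono) (auto simp: K_def)
      finally show ?thesis using True \<open>K * real p powr _ \<ge> _\<close> by simp
    next
      case False
      have "real (a + 1) \<le> 2 ^ a" by (induction a) auto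
      also have "\<dots> = 2 powr real a" by (simp add: powr_realpow)
      also have "\<dots> = (B powr \<delta>) powr real a" using assms by (simp add: B_def powr_powr)
      also have "\<dots> \<le> (real p powr \<delta>) powr real a"
        using False assms by (intro powr_mono2) (auto simp: B_def)
      finally show ?thesis using False by (simp add: powr_powr)
    qed
  qed
  have main: "real (card {d. d dvd n}) \<le> K ^ card (Q n) * real n powr \<delta>" if "n > 0" for n
    using that
  proof (induction n rule: less_induct)
    case (less n)
    show ?case
    proof (cases "n = 1")
      case True
      then show ?thesis using K by simp
    next
      case False
      then obtain p where p: "prime p" "p dvd n" using prime_factor_nat by blast
      \<comment> \<open>Removing the full power of \<open>p\<close> leaves \<open>m\<close> free of
        \<open>p\<close>. A small prime therefore enters \<open>Q n\<close> once and pays for one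
        factor \<open>K\<close>.\<close>
      define a where "a = multiplicity p n"
      obtain m where m: "n = p ^ a * m" "\<not> p dvd m"
        using multiplicity_decompose'[of n p] less.prems p unfolding a_def
        by (metis not_prime_unit not_less_zero)
      have a0: "a > 0" using p less.prems by (simp add: a_def prime_multiplicity_gt_zero_iff)
      have m0: "m > 0" using m less.prems by (cases m) auto
      have "p ^ a > 1" using a0 prime_gt_1_nat[OF p(1)] by (intro one_less_power)
      then have mn: "m < n" using m m0 by simp
      have "real (card {d. d dvd n}) \<le> real (a + 1) * real (card {d. d dvd m})"
        using card_divisors_prime_power_mult[OF p(1) m0, of a] m(1) by (metis of_nat_le_iff of_nat_mult)
      also have "\<dots> \<le> ((if real p < B then K else 1) * real p powr (\<delta> * real a)) * (K ^ card (Q m) * real m powr \<delta>)"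
        by (rule mult_mono[OF pp[OF p(1)] less.IH[OF mn m0]]) (use K in auto)
      also have "\<dots> = ((if real p < B then K else 1) * K ^ card (Q m)) * (real p powr (\<delta> * real a) * real m powr \<delta>)"
        by simp
      also have "real p powr (\<delta> * real a) * real m powr \<delta> = real n powr \<delta>"
      proof -
        have "real p powr (\<delta> * real a) = (real p ^ a) powr \<delta>"
          using prime_gt_0_nat[OF p(1)] by (simp add: powr_powr mult.commute flip: powr_realpow)
        then show ?thesis by (simp add: m(1) powr_mult)
      qed
      also have "(if real p < B then K else 1) * K ^ card (Q m) \<le> K ^ card (Q n)"
      proof (cases "real p < B")
        case True
        have "insert p (Q m) \<subseteq> Q n" "p \<notin> Q m" using True p m by (auto simp: Q_def)
        then have "Suc (card (Q m)) \<le> card (Q n)"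
          using card_mono[OF fQ[OF less.prems] \<open>insert p (Q m) \<subseteq> Q n\<close>] fQ[OF m0] by simp
        then have "K ^ Suc (card (Q m)) \<le> K ^ card (Q n)" using K by (rule power_increasing)
        then show ?thesis using True by simp
      next
        case False
        have "Q m \<subseteq> Q n" using m by (auto simp: Q_def)
        then have "card (Q m) \<le> card (Q n)" using fQ[OF less.prems] by (rule_tac card_mono)
        then show ?thesis using False K by (simp add: power_increasing)
      qed
      finally show ?thesis by (simp add: mult_right_mono)
    qed
  qed
  \<comment> \<open>The number of naturals below \<open>B\<close> bounds \<open>card (Q n)\<close>
    for every \<open>n\<close>, which makes the constant uniform.\<close>
  have fin: "finite {p::nat. real p < B}"
    by (rule finite_subset[of _ "{..nat \<lceil>B\<rceil>}"]) (auto, linarith)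
  show ?thesis
  proof
    show "K ^ card {p::nat. real p < B} > 0" using K by simp
    fix n :: nat assume n: "n > 0"
    have "card (Q n) \<le> card {p::nat. real p < B}" by (rule card_mono[OF fin]) (auto simp: Q_def)
    then have "K ^ card (Q n) * real n powr \<delta> \<le> K ^ card {p::nat. real p < B} * real n powr \<delta>"
      using K by (intro mult_right_mono power_increasing) auto
    with main[OF n] show "real (card {d. d dvd n}) \<le> K ^ card {p::nat. real p < B} * real n powr \<delta>"
      by linarith
  qed
qed

subsection \<open>Exponential sums over squares\<close>

text \<open>The additive character usually written e(k/q). The argument is an integer so that
  negative frequencies and differences of residues make sense.\<close>

definition add_char :: "nat \<Rightarrow> int \<Rightarrow> complex" where
  "add_char q k = cis (2 * pi * of_int k / of_nat q)"

lemma add_char_0 [simp]: "add_char q 0 = 1"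
  by (simp add: add_char_def)

lemma norm_add_char [simp]: "norm (add_char q k) = 1"
  by (simp add: add_char_def)

lemma add_char_add: "add_char q (j + k) = add_char q j * add_char q k"
  by (simp add: add_char_def cis_mult add_divide_distrib distrib_left)

lemma cnj_add_char: "cnj (add_char q k) = add_char q (- k)"
  by (simp add: add_char_def cis_cnj)

lemma add_char_of_nat_mult: "add_char q (int n * k) = add_char q k ^ n"
proof -
  have "2 * pi * real_of_int (int n * k) / real q = real n * (2 * pi * real_of_int k / real q)"
    by simp
  then show ?thesis unfolding add_char_def Complex.DeMoivre by (simp only:)
qed

lemma add_char_eq_1_iff:
  assumes "q > 0"
  shows "add_char q k = 1 \<longleftrightarrow> int q dvd k"
proof
  assume "int q dvd k"
  then obtain j where "k = int q * j" by (elim dvdE)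
  then show "add_char q k = 1"
    using assms cis_multiple_2pi[of "of_int j"] by (simp add: add_char_def mult.assoc)
next
  assume "add_char q k = 1"
  then have "cos (2 * pi * of_int k / of_nat q) = 1"
    by (simp add: add_char_def complex_eq_iff)
  then obtain n :: int where "2 * pi * of_int k / of_nat q = of_int n * 2 * pi"
    by (subst (asm) cos_one_2pi_int) auto
  then have "real_of_int k = real_of_int (n * int q)"
    using assms by (simp add: field_simps)
  then have "k = n * int q" by (simp only: of_int_eq_iff)
  then show "int q dvd k" by simp
qed

lemma add_char_cong:
  assumes "q > 0" "[j = k] (mod int q)"
  shows "add_char q j = add_char q k"
proof -
  have "int q dvd j - k" using assms(2) by (simp add: cong_iff_dvd_diff)
  then have "add_char q (j - k) = 1" using assms(1) by (simp add: add_char_eq_1_iff)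
  moreover have "add_char q j = add_char q (j - k) * add_char q k"
    by (simp flip: add_char_add)
  ultimately show ?thesis by simp
qed

text \<open>Orthogonality of characters: the terms are powers of a \<open>q\<close>-th root of
  unity, and the geometric series vanishes unless that root is \<open>1\<close>.\<close>

lemma sum_add_char:
  assumes "q > 0"
  shows "(\<Sum>h<q. add_char q (int h * k)) = (if int q dvd k then of_nat q else 0)"
proof (cases "int q dvd k")
  case True
  then have "add_char q k = 1" using assms by (simp add: add_char_eq_1_iff)
  then show ?thesis using True by (simp add: add_char_of_nat_mult)
next
  case False
  then have ne: "add_char q k \<noteq> 1" using assms by (simp add: add_char_eq_1_iff)
  have "add_char q k ^ q = 1"
    using assms by (simp add: add_char_eq_1_iff flip: add_char_of_nat_mult)
  then show ?thesis using False ne by (simp add: add_char_of_nat_mult geometric_sum)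
qed

text \<open>Expanding the square and summing over \<open>a\<close> first leaves, by orthogonality,
  only the diagonal \<open>j = h\<close>.\<close>

lemma parseval_add_char:
  fixes c :: "nat \<Rightarrow> complex"
  assumes "q > 0"
  shows "(\<Sum>a<q. (norm (\<Sum>h<q. c h * add_char q (- (int h * int a))))\<^sup>2) = q * (\<Sum>h<q. (norm (c h))\<^sup>2)"
proof -
  have "complex_of_real (\<Sum>a<q. (norm (\<Sum>h<q. c h * add_char q (- (int h * int a))))\<^sup>2)
    = (\<Sum>a<q. (\<Sum>h<q. c h * add_char q (- (int h * int a))) * (\<Sum>j<q. cnj (c j) * add_char q (int j * int a)))"
    by (simp only: of_real_sum complex_norm_square cnj_sum complex_cnj_mult cnj_add_char minus_minus)
  also have "\<dots> = (\<Sum>a<q. \<Sum>h<q. \<Sum>j<q. (c h * cnj (c j)) * add_char q (int a * (int j - int h)))"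
  proof (intro sum.cong refl, subst sum_product, intro sum.cong refl)
    fix a h j
    have "add_char q (int a * (int j - int h)) = add_char q (- (int h * int a)) * add_char q (int j * int a)"
      by (simp add: algebra_simps flip: add_char_add)
    then show "c h * add_char q (- (int h * int a)) * (cnj (c j) * add_char q (int j * int a))
        = (c h * cnj (c j)) * add_char q (int a * (int j - int h))" by simp
  qed
  also have "\<dots> = (\<Sum>h<q. \<Sum>a<q. \<Sum>j<q. (c h * cnj (c j)) * add_char q (int a * (int j - int h)))"
    by (rule sum.swap)
  also have "\<dots> = (\<Sum>h<q. \<Sum>j<q. \<Sum>a<q. (c h * cnj (c j)) * add_char q (int a * (int j - int h)))"
    by (intro sum.cong refl sum.swap)
  also have "\<dots> = (\<Sum>h<q. \<Sum>j<q. (c h * cnj (c j)) * (\<Sum>a<q. add_char q (int a * (int j - int h))))"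
    by (simp only: sum_distrib_left)
  also have "\<dots> = (\<Sum>h<q. \<Sum>j<q. if j = h then q * (c h * cnj (c h)) else 0)"
  proof (intro sum.cong refl)
    fix h j assume hj: "h \<in> {..<q}" "j \<in> {..<q}"
    have "int q dvd int j - int h \<longleftrightarrow> j = h"
    proof
      assume "int q dvd int j - int h"
      then have "[int j = int h] (mod int q)" by (simp add: cong_iff_dvd_diff)
      then show "j = h" using hj by (simp add: cong_def)
    qed simp
    then show "(c h * cnj (c j)) * (\<Sum>a<q. add_char q (int a * (int j - int h)))
        = (if j = h then q * (c h * cnj (c h)) else 0)"
      using assms by (simp add: sum_add_char)
  qed
  also have "\<dots> = (\<Sum>h<q. q * (c h * cnj (c h)))" by simp
  also have "\<dots> = complex_of_real (q * (\<Sum>h<q. (norm (c h))\<^sup>2))"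
    by (simp only: of_real_mult of_real_sum complex_norm_square of_real_of_nat_eq sum_distrib_left)
  finally show ?thesis by (simp only: of_real_eq_iff)
qed

section \<open>Geometric series and their weights\<close>

lemma two_mult_le_sin_pi:
  fixes t :: real
  assumes "0 \<le> t" "t \<le> 1 / 2"
  shows "2 * t \<le> sin (pi * t)"
proof -
  \<comment> \<open>Jordan's inequality: a concave function lies above its chord, here the one from
    \<open>0\<close> to \<open>pi / 2\<close>.\<close>
  have "concave_on {0..pi/2} sin"
    by (rule f''_le0_imp_concave[where f' = cos and f'' = "\<lambda>x. - sin x"])
       (auto intro!: derivative_eq_intros sin_ge_zero)
  from concave_onD[OF this, of "2 * t" 0 "pi / 2"]
  have "(1 - 2 * t) * sin 0 + 2 * t * sin (pi / 2) \<le> sin ((1 - 2 * t) * 0 + 2 * t * (pi / 2))"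
    using assms by simp
  then show ?thesis by (simp add: mult.commute)
qed

text \<open>The product \<open>t * (1 - t)\<close> replaces the distance from \<open>t\<close> to
  the nearest integer. It is of the same size and symmetric under \<open>t\<close> to
  \<open>1 - t\<close>, which reduces everything to \<open>t \<le> 1 / 2\<close>.\<close>

lemma two_mult_one_minus_le_sin_pi:
  fixes t :: real
  assumes "0 \<le> t" "t \<le> 1"
  shows "2 * t * (1 - t) \<le> sin (pi * t)"
proof (cases "t \<le> 1 / 2")
  case True
  have "2 * t * (1 - t) \<le> 2 * t * 1" using assms by (intro mult_left_mono) auto
  then show ?thesis using two_mult_le_sin_pi[of t] True assms by simp
next
  case False
  have "(1 - t) * 2 * t \<le> (1 - t) * 2 * 1" using assms by (intro mult_left_mono) auto
  moreover have "2 * (1 - t) \<le> sin (pi * (1 - t))" using two_mult_le_sin_pi[of "1 - t"] False assms by simp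
  moreover have "sin (pi * (1 - t)) = sin (pi * t)"
    using sin_pi_minus[of "pi * t"] by (simp add: algebra_simps)
  ultimately show ?thesis by (simp add: mult_ac)
qed

lemma norm_one_minus_cis: "norm (1 - cis (2 * x)) = 2 * \<bar>sin x\<bar>"
proof -
  have "(norm (1 - cis (2 * x)))\<^sup>2 = (1 - cos (2 * x))\<^sup>2 + (sin (2 * x))\<^sup>2"
    by (simp add: cmod_power2)
  also have "\<dots> = (2 * (sin x)\<^sup>2)\<^sup>2 + (2 * sin x)\<^sup>2 * (cos x)\<^sup>2"
    by (simp add: cos_double_sin sin_double power_mult_distrib)
  also have "\<dots> = (2 * \<bar>sin x\<bar>)\<^sup>2"
    unfolding cos_squared_eq by (simp add: power2_eq_square algebra_simps)
  finally show ?thesis by (rule power2_eq_imp_eq) auto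
qed

text \<open>With \<open>t = k / q\<close> and \<open>0 < k < q\<close> this is
  \<open>1 / (2 * t * (1 - t))\<close>, within a factor \<open>2\<close> of the reciprocal distance
  of \<open>k / q\<close> to the nearest integer. The partial fraction form makes its sum over
  \<open>k\<close> harmonic.\<close>

definition geom_weight :: "nat \<Rightarrow> nat \<Rightarrow> real" where
  "geom_weight q k = real q / 2 * (1 / real k + 1 / (real q - real k))"

lemma geom_weight_nonneg: "k < q \<Longrightarrow> geom_weight q k \<ge> 0"
  by (simp add: geom_weight_def)

text \<open>In the closed form of the geometric series the numerator has norm at most
  \<open>2\<close>, and the denominator has norm \<open>2 * sin (pi * t)\<close>, at least
  \<open>4 * t * (1 - t)\<close>. The bound does not depend on the length \<open>n\<close>.\<close>

lemma norm_sum_add_char_le: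
  assumes "0 < k" "k < q"
  shows "norm (\<Sum>m\<in>{1..n}. add_char q (int m * int k)) \<le> geom_weight q k"
proof -
  define z where "z = add_char q (int k)"
  define t where "t = real k / real q"
  have t: "0 < t" "t < 1" using assms by (auto simp: t_def)
  have "(1 - z) * (\<Sum>m\<in>{1..n}. z ^ m) = z - z ^ Suc n"
  proof (induction n)
    case (Suc n)
    have "(1 - z) * (\<Sum>m\<in>{1..Suc n}. z ^ m) = (1 - z) * (\<Sum>m\<in>{1..n}. z ^ m) + (1 - z) * z ^ Suc n"
      by (simp add: distrib_left)
    also have "\<dots> = z - z ^ Suc (Suc n)"
      unfolding Suc.IH by (simp add: left_diff_distrib)
    finally show ?case .
  qed simp
  then have "norm (1 - z) * norm (\<Sum>m\<in>{1..n}. z ^ m) = norm (z - z ^ Suc n)"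
    by (metis norm_mult)
  also have "\<dots> \<le> norm z + norm (z ^ Suc n)" by (rule norm_triangle_ineq4)
  also have "\<dots> = 2" by (simp add: z_def norm_mult norm_power)
  finally have 1: "norm (1 - z) * norm (\<Sum>m\<in>{1..n}. z ^ m) \<le> 2" .
  have "norm (1 - z) = 2 * \<bar>sin (pi * t)\<bar>"
    using norm_one_minus_cis[of "pi * t"] by (simp add: z_def add_char_def t_def mult_ac)
  then have 2: "norm (1 - z) \<ge> 4 * t * (1 - t)"
    using two_mult_one_minus_le_sin_pi[of t] t by linarith
  have pos: "4 * t * (1 - t) > 0" using t by simp
  have "4 * t * (1 - t) * norm (\<Sum>m\<in>{1..n}. z ^ m) \<le> 2"
    using mult_right_mono[OF 2 norm_ge_zero[of "\<Sum>m\<in>{1..n}. z ^ m"]] 1 by linarith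
  then have "norm (\<Sum>m\<in>{1..n}. z ^ m) \<le> 2 / (4 * t * (1 - t))"
    using pos by (subst pos_le_divide_eq) (simp_all add: mult_ac)
  also have "\<dots> = geom_weight q k"
    using assms unfolding t_def geom_weight_def by (simp add: field_simps)
  finally show ?thesis by (simp add: add_char_of_nat_mult z_def)
qed

text \<open>The reflection of \<open>k\<close> to \<open>q - k\<close> exchanges the two partial
  fractions, so both contribute the same harmonic sum.\<close>

lemma sum_geom_weight_le:
  assumes "q > 0"
  shows "(\<Sum>k\<in>{1..<q}. geom_weight q k) \<le> real q * harm q"
proof -
  have "(\<Sum>k\<in>{1..<q}. 1 / (real q - real k)) = (\<Sum>k\<in>{1..<q}. 1 / real k)"
    by (rule sum.reindex_bij_witness[of _ "\<lambda>k. q - k" "\<lambda>k. q - k"]) (auto simp: of_nat_diff)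
  moreover have "(\<Sum>k\<in>{1..<q}. 1 / real k) \<le> harm q"
    unfolding harm_def inverse_eq_divide by (rule sum_mono2) auto
  moreover have "(\<Sum>k\<in>{1..<q}. geom_weight q k)
      = real q / 2 * ((\<Sum>k\<in>{1..<q}. 1 / real k) + (\<Sum>k\<in>{1..<q}. 1 / (real q - real k)))"
    by (simp only: geom_weight_def sum.distrib sum_distrib_left[symmetric])
  ultimately show ?thesis using assms by simp
qed

section \<open>Exponential sums over the squares coprime to \<open>q\<close>\<close>

context
  fixes q N :: nat and D :: "nat set"
  assumes q: "q > 0"
  defines "D \<equiv> {d\<in>{1..N}. coprime d q}"
begin

text \<open>The maximum bound for one frequency. The weight depends only on the fraction
  \<open>h * d\<^sup>2 / q\<close>, so the gcd of \<open>h\<close> and \<open>q\<close> can be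
  cancelled. By \<open>square_root_count\<close> each residue modulo the reduced \<open>q'\<close>
  then arises from boundedly many \<open>d\<close>, up to the divisor count, and the weights are
  summed over residues.\<close>

lemma sum_geom_weight_square_le:
  assumes "h \<in> {1..<q}"
  shows "(\<Sum>d\<in>D. geom_weight q (h * d\<^sup>2 mod q)) \<le> real (card {u. u dvd q}) * harm q * (2 * N + q)"
proof -
  define g where "g = gcd h q"
  define q' where "q' = q div g"
  define h' where "h' = h div g"
  have g: "g > 0" using q by (simp add: g_def)
  have qq: "q = g * q'" and hh: "h = g * h'" by (auto simp: q'_def h'_def g_def)
  have cop: "coprime h' q'" unfolding h'_def q'_def g_def using q by (intro div_gcd_coprime) auto
  have q'0: "q' > 0" using qq q by (cases q') auto
  \<comment> \<open>This is where \<open>0 < h < q\<close> enters. It keeps the residues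
    \<open>f d\<close> away from \<open>0\<close>, where a geometric series would not be
    small.\<close>
  have q'1: "q' > 1"
  proof (rule ccontr)
    assume "\<not> q' > 1"
    then have "q = g" using qq q'0 by (simp add: le_less_Suc_eq)
    then have "q dvd h" unfolding g_def by (metis gcd_dvd1)
    then show False using assms by (auto dest: dvd_imp_le)
  qed
  define f where "f = (\<lambda>d. h' * d\<^sup>2 mod q')"
  have weight: "geom_weight q (g * k) = geom_weight q' k" for k
  proof -
    have "real q - real (g * k) = real g * (real q' - real k)"
      by (simp add: qq right_diff_distrib)
    then have "geom_weight q (g * k)
        = (real g * real q') / 2 * (1 / (real g * real k) + 1 / (real g * (real q' - real k)))"
      by (simp add: geom_weight_def flip: qq of_nat_mult)
    also have "\<dots> = geom_weight q' k"
      using g unfolding geom_weight_def distrib_left by simp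
    finally show ?thesis .
  qed
  have f_in: "f ` D \<subseteq> {1..<q'}"
  proof safe
    fix d assume d: "d \<in> D"
    then have "coprime d q'" using qq by (simp add: D_def)
    then have "coprime (h' * d\<^sup>2) q'" using cop by simp
    then have "\<not> q' dvd h' * d\<^sup>2"
      using coprime_common_divisor[of "h' * d\<^sup>2" q' q'] q'1 by auto
    then have "f d > 0" unfolding f_def using mod_0_imp_dvd by blast
    then show "f d \<in> {1..<q'}" using q'0 by (simp add: f_def)
  qed
  have "(\<Sum>d\<in>D. geom_weight q (h * d\<^sup>2 mod q)) = (\<Sum>d\<in>D. geom_weight q' (f d))"
  proof (rule sum.cong)
    fix d assume "d \<in> D"
    have "h * d\<^sup>2 mod q = g * f d" unfolding f_def mult_mod_right by (simp add: hh qq mult.assoc)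
    then show "geom_weight q (h * d\<^sup>2 mod q) = geom_weight q' (f d)"
      using weight[of "f d"] q'0 by (simp add: f_def)
  qed simp
  also have "\<dots> = (\<Sum>k\<in>{1..<q'}. \<Sum>d\<in>{d\<in>D. f d = k}. geom_weight q' (f d))"
    by (rule sum.group[symmetric]) (use f_in in \<open>auto simp: D_def\<close>)
  also have "\<dots> = (\<Sum>k\<in>{1..<q'}. real (card {d\<in>D. f d = k}) * geom_weight q' k)"
    by (intro sum.cong) auto
  also have "\<dots> \<le> (\<Sum>k\<in>{1..<q'}. (real (card {u. u dvd q}) * (2 * real N / real q' + 1)) * geom_weight q' k)"
  proof (intro sum_mono mult_right_mono)
    fix k assume k: "k \<in> {1..<q'}"
    show "geom_weight q' k \<ge> 0" using k by (simp add: geom_weight_nonneg)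
    have "card {d\<in>D. f d = k} \<le> card {d\<in>{1..N}. coprime d q' \<and> [h' * d\<^sup>2 = k] (mod q')}"
      by (rule card_mono) (use k qq in \<open>auto simp: D_def f_def cong_def\<close>)
    then have "real (card {d\<in>D. f d = k}) \<le> real (card {u. u dvd q'}) * (2 * real N / real q' + 1)"
      using square_root_count[OF q'0 cop, of N k] by linarith
    also have "\<dots> \<le> real (card {u. u dvd q}) * (2 * real N / real q' + 1)"
      using card_divisors_mono[of q' q] qq q by (intro mult_right_mono) auto
    finally show "real (card {d\<in>D. f d = k}) \<le> real (card {u. u dvd q}) * (2 * real N / real q' + 1)" .
  qed
  also have "\<dots> = (real (card {u. u dvd q}) * (2 * real N / real q' + 1)) * (\<Sum>k\<in>{1..<q'}. geom_weight q' k)"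
    by (simp add: sum_distrib_left)
  \<comment> \<open>The factor \<open>q'\<close> clears the denominator, and what remains is
    increasing in \<open>q'\<close>, so \<open>q'\<close> may be replaced by
    \<open>q\<close>.\<close>
  also have "\<dots> \<le> (real (card {u. u dvd q}) * (2 * real N / real q' + 1)) * (real q' * harm q')"
    by (intro mult_left_mono sum_geom_weight_le q'0) auto
  also have "\<dots> = real (card {u. u dvd q}) * harm q' * (2 * N + q')"
    using q'0 by (simp add: field_simps)
  also have "\<dots> \<le> real (card {u. u dvd q}) * harm q * (2 * N + q)"
  proof -
    have "q' \<le> q" using g by (simp add: qq)
    then show ?thesis
      by (intro mult_mono mult_left_mono harm_mono) (auto intro: harm_nonneg mult_nonneg_nonneg)
  qed
  finally show ?thesis .
qed

text \<open>For fixed \<open>d\<close> coprime to \<open>q\<close>, multiplication by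
  \<open>d\<^sup>2\<close> permutes the nonzero residues, so the sum over \<open>h\<close> is the
  complete sum of weights for each \<open>d\<close>.\<close>

lemma sum_sum_geom_weight_square_le:
  "(\<Sum>h\<in>{1..<q}. \<Sum>d\<in>D. geom_weight q (h * d\<^sup>2 mod q)) \<le> real N * (real q * harm q)"
proof -
  have "(\<Sum>h\<in>{1..<q}. \<Sum>d\<in>D. geom_weight q (h * d\<^sup>2 mod q)) = (\<Sum>d\<in>D. \<Sum>h\<in>{1..<q}. geom_weight q (h * d\<^sup>2 mod q))"
    by (rule sum.swap)
  also have "\<dots> = (\<Sum>d\<in>D. \<Sum>k\<in>{1..<q}. geom_weight q k)"
  proof (rule sum.cong)
    fix d assume d: "d \<in> D"
    then have cop: "coprime (d\<^sup>2) q" by (simp add: D_def)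
    have inj: "inj_on (\<lambda>h. h * d\<^sup>2 mod q) {1..<q}"
    proof (rule inj_onI)
      fix h j assume hj: "h \<in> {1..<q}" "j \<in> {1..<q}" "h * d\<^sup>2 mod q = j * d\<^sup>2 mod q"
      then have "[h * d\<^sup>2 = j * d\<^sup>2] (mod q)" by (simp add: cong_def)
      then have "[h = j] (mod q)" using cop by (simp add: cong_mult_rcancel_nat)
      then show "h = j" using hj by (simp add: cong_def)
    qed
    have sub: "(\<lambda>h. h * d\<^sup>2 mod q) ` {1..<q} \<subseteq> {1..<q}"
    proof safe
      fix h assume h: "h \<in> {1..<q}"
      have "\<not> q dvd h * d\<^sup>2"
        using cop h by (auto simp: coprime_dvd_mult_left_iff coprime_commute dest: dvd_imp_le)
      then have "h * d\<^sup>2 mod q > 0" using mod_0_imp_dvd by blast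
      then show "h * d\<^sup>2 mod q \<in> {1..<q}" using q by simp
    qed
    have "bij_betw (\<lambda>h. h * d\<^sup>2 mod q) {1..<q} {1..<q}"
      unfolding bij_betw_def using inj endo_inj_surj[OF finite_atLeastLessThan sub inj] by blast
    then show "(\<Sum>h\<in>{1..<q}. geom_weight q (h * d\<^sup>2 mod q)) = (\<Sum>k\<in>{1..<q}. geom_weight q k)"
      by (rule sum.reindex_bij_betw)
  qed simp
  also have "\<dots> \<le> (\<Sum>d\<in>D. real q * harm q)" by (intro sum_mono sum_geom_weight_le q)
  also have "\<dots> = real (card D) * (real q * harm q)" by simp
  also have "\<dots> \<le> real N * (real q * harm q)"
  proof (intro mult_right_mono)
    have "card D \<le> card {1..N}" by (rule card_mono) (auto simp: D_def)
    then show "real (card D) \<le> real N" by simp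
  qed (auto intro: mult_nonneg_nonneg harm_nonneg)
  finally show ?thesis .
qed

text \<open>Detecting the congruence by characters makes \<open>T h\<close> the Fourier coefficients
  of \<open>q\<close> times the inner sum. Parseval then reduces the claim to the sum of the squares
  of \<open>norm (T h)\<close>, which is at most the maximum bound times the sum of the
  majorants.\<close>

lemma second_moment_square_classes:
  fixes w :: "nat \<Rightarrow> real" and n :: "nat \<Rightarrow> nat"
  assumes w: "\<And>d. \<bar>w d\<bar> \<le> 1"
  shows "(\<Sum>a<q. (\<Sum>d\<in>D. w d * (real (card {m\<in>{1..n d}. [m * d\<^sup>2 = a] (mod q)}) - real (n d) / q))\<^sup>2)
         \<le> real (card {u. u dvd q}) * (harm q)\<^sup>2 * N * (2 * N + q)"
proof -
  define T where "T = (\<lambda>h. \<Sum>d\<in>D. of_real (w d) * (\<Sum>m\<in>{1..n d}. add_char q (int m * int (h * d\<^sup>2 mod q))))"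
  \<comment> \<open>Frequency \<open>0\<close> is absent because the expected count
    \<open>n d / q\<close> has been subtracted.\<close>
  define c where "c = (\<lambda>h::nat. if h = 0 then 0 else T h)"
  define A where "A = (\<lambda>a. \<Sum>d\<in>D. w d * (real (card {m\<in>{1..n d}. [m * d\<^sup>2 = a] (mod q)}) - real (n d) / q))"
  have count: "of_real (q * (real (card {m\<in>{1..M}. [m * d\<^sup>2 = a] (mod q)}) - real M / q))
      = (\<Sum>h\<in>{1..<q}. (\<Sum>m\<in>{1..M}. add_char q (int m * int (h * d\<^sup>2 mod q))) * add_char q (- (int h * int a)))"
    for a d M
  proof -
    have "complex_of_nat q * of_nat (card {m\<in>{1..M}. [m * d\<^sup>2 = a] (mod q)})
        = (\<Sum>m\<in>{1..M}. if int q dvd int m * (int d)\<^sup>2 - int a then of_nat q else 0)"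
    proof -
      have "[m * d\<^sup>2 = a] (mod q) \<longleftrightarrow> int q dvd int m * (int d)\<^sup>2 - int a" for m
        by (simp add: cong_iff_dvd_diff flip: cong_int_iff)
      then show ?thesis by (simp add: sum.inter_filter[symmetric] mult.commute)
    qed
    also have "\<dots> = (\<Sum>m\<in>{1..M}. \<Sum>h<q. add_char q (int h * (int m * (int d)\<^sup>2 - int a)))"
      using q by (simp add: sum_add_char)
    also have "\<dots> = (\<Sum>h<q. \<Sum>m\<in>{1..M}. add_char q (int h * (int m * (int d)\<^sup>2 - int a)))"
      by (rule sum.swap)
    also have "\<dots> = (\<Sum>h<q. (\<Sum>m\<in>{1..M}. add_char q (int m * int (h * d\<^sup>2 mod q))) * add_char q (- (int h * int a)))"
      unfolding sum_distrib_right
    proof (intro sum.cong refl)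
      fix h m
      have "[int m * int (h * d\<^sup>2 mod q) = int m * int (h * d\<^sup>2)] (mod int q)"
        by (rule cong_scalar_left) (simp add: zmod_int cong_def)
      then have "add_char q (int m * int (h * d\<^sup>2 mod q)) = add_char q (int m * int (h * d\<^sup>2))"
        using q by (rule_tac add_char_cong)
      then show "add_char q (int h * (int m * (int d)\<^sup>2 - int a))
          = add_char q (int m * int (h * d\<^sup>2 mod q)) * add_char q (- (int h * int a))"
        by (simp add: algebra_simps flip: add_char_add)
    qed
    \<comment> \<open>Frequency \<open>0\<close> contributes \<open>M\<close>, exactly
      \<open>q\<close> times the subtracted average.\<close>
    also have "{..<q} = insert 0 {1..<q}" using q by auto
    also have "(\<Sum>h\<in>insert 0 {1..<q}. (\<Sum>m\<in>{1..M}. add_char q (int m * int (h * d\<^sup>2 mod q))) * add_char q (- (int h * int a)))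
      = of_nat M + (\<Sum>h\<in>{1..<q}. (\<Sum>m\<in>{1..M}. add_char q (int m * int (h * d\<^sup>2 mod q))) * add_char q (- (int h * int a)))"
      by simp
    finally show ?thesis using q by (simp add: field_simps)
  qed
  have "complex_of_real (q * A a) = (\<Sum>h<q. c h * add_char q (- (int h * int a)))" for a
  proof -
    have "complex_of_real (q * A a) = (\<Sum>d\<in>D. of_real (w d) *
        of_real (q * (real (card {m\<in>{1..n d}. [m * d\<^sup>2 = a] (mod q)}) - real (n d) / q)))"
      by (simp add: A_def sum_distrib_left mult_ac)
    also have "\<dots> = (\<Sum>d\<in>D. \<Sum>h\<in>{1..<q}. of_real (w d) *
        (\<Sum>m\<in>{1..n d}. add_char q (int m * int (h * d\<^sup>2 mod q))) * add_char q (- (int h * int a)))"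
      unfolding count
      by (intro sum.cong refl, subst sum_distrib_left) (simp only: mult.assoc)
    also have "\<dots> = (\<Sum>h\<in>{1..<q}. T h * add_char q (- (int h * int a)))"
      by (subst sum.swap) (simp add: T_def sum_distrib_right)
    also have "\<dots> = (\<Sum>h<q. c h * add_char q (- (int h * int a)))"
      by (rule sum.mono_neutral_cong_left) (auto simp: c_def)
    finally show ?thesis .
  qed
  then have "norm (\<Sum>h<q. c h * add_char q (- (int h * int a))) = \<bar>q * A a\<bar>" for a
    by (metis norm_of_real real_norm_def)
  then have "(\<Sum>a<q. \<bar>q * A a\<bar>\<^sup>2) = q * (\<Sum>h<q. (norm (c h))\<^sup>2)"
    using parseval_add_char[OF q, of c] by simp
  also have "(\<Sum>a<q. \<bar>q * A a\<bar>\<^sup>2) = (real q)\<^sup>2 * (\<Sum>a<q. (A a)\<^sup>2)"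
    by (simp add: power_mult_distrib sum_distrib_left)
  finally have qA: "real q * (\<Sum>a<q. (A a)\<^sup>2) = (\<Sum>h<q. (norm (c h))\<^sup>2)"
    using q by (simp add: power2_eq_square mult.assoc)
  define G where "G = (\<lambda>h. \<Sum>d\<in>D. geom_weight q (h * d\<^sup>2 mod q))"
  define X where "X = real (card {u. u dvd q}) * harm q * (2 * N + q)"
  have X0: "X \<ge> 0" by (auto simp: X_def intro!: mult_nonneg_nonneg harm_nonneg)
  have G0: "G h \<ge> 0" for h using q by (auto simp: G_def intro!: sum_nonneg geom_weight_nonneg)
  have TG: "norm (T h) \<le> G h" if h: "h \<in> {1..<q}" for h
    unfolding T_def G_def
  proof (rule order_trans[OF norm_sum], rule sum_mono)
    fix d assume d: "d \<in> D"
    then have cop: "coprime (d\<^sup>2) q" by (simp add: D_def)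
    have "\<not> q dvd h * d\<^sup>2"
      using cop h by (auto simp: coprime_dvd_mult_left_iff coprime_commute dest: dvd_imp_le)
    then have "0 < h * d\<^sup>2 mod q" using mod_0_imp_dvd by blast
    then have "norm (\<Sum>m\<in>{1..n d}. add_char q (int m * int (h * d\<^sup>2 mod q))) \<le> geom_weight q (h * d\<^sup>2 mod q)"
      using q by (intro norm_sum_add_char_le) auto
    then have "\<bar>w d\<bar> * norm (\<Sum>m\<in>{1..n d}. add_char q (int m * int (h * d\<^sup>2 mod q))) \<le> 1 * geom_weight q (h * d\<^sup>2 mod q)"
      using w[of d] by (intro mult_mono) auto
    then show "norm (of_real (w d) * (\<Sum>m\<in>{1..n d}. add_char q (int m * int (h * d\<^sup>2 mod q)))) \<le> geom_weight q (h * d\<^sup>2 mod q)"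
      by (simp add: norm_mult)
  qed
  have "(\<Sum>h<q. (norm (c h))\<^sup>2) = (\<Sum>h\<in>{1..<q}. (norm (T h))\<^sup>2)"
    by (rule sum.mono_neutral_cong_right) (auto simp: c_def)
  \<comment> \<open>One factor \<open>norm (T h)\<close> is bounded by the uniform \<open>X\<close>,
    the other by \<open>G h\<close>, which is then averaged over \<open>h\<close>.\<close>
  also have "\<dots> \<le> (\<Sum>h\<in>{1..<q}. X * G h)"
  proof (rule sum_mono)
    fix h assume h: "h \<in> {1..<q}"
    have "G h \<le> X" unfolding G_def X_def by (rule sum_geom_weight_square_le[OF h])
    then have "norm (T h) * norm (T h) \<le> X * G h" using TG[OF h] G0[of h] by (intro mult_mono) auto
    then show "(norm (T h))\<^sup>2 \<le> X * G h" by (simp add: power2_eq_square)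
  qed
  also have "\<dots> = X * (\<Sum>h\<in>{1..<q}. G h)" by (simp add: sum_distrib_left)
  also have "\<dots> \<le> X * (real N * (real q * harm q))"
    unfolding G_def by (intro mult_left_mono sum_sum_geom_weight_square_le X0)
  also have "\<dots> = real q * (real (card {u. u dvd q}) * (harm q)\<^sup>2 * N * (2 * N + q))"
    by (simp add: X_def power2_eq_square)
  finally have "(\<Sum>a<q. (A a)\<^sup>2) \<le> real (card {u. u dvd q}) * (harm q)\<^sup>2 * N * (2 * N + q)"
    using q unfolding qA[symmetric] by simp
  then show ?thesis by (simp only: A_def)
qed

end

subsection \<open>The second moment of the error term\<close>

lemma sum_inverse_sqrt_le: "(\<Sum>m\<in>{1..M}. 1 / sqrt (real m)) \<le> 2 * sqrt (real M)"
proof (induction M)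
  case (Suc M)
  define s where "s = sqrt (real M)"
  define t where "t = sqrt (real (Suc M))"
  have st: "s \<ge> 0" "t > 0" "s \<le> t" "t * t = s * s + 1" by (auto simp: s_def t_def)
  \<comment> \<open>Combined with \<open>t * t = s * s + 1\<close> this gives
    \<open>1 / t \<le> 2 * (t - s)\<close>, which telescopes.\<close>
  have "2 * s * t \<le> s * s + t * t" using sum_squares_ge_zero[of "s - t" 0] by (simp add: algebra_simps)
  then have "2 * s * t + 1 \<le> 2 * t * t" using st by simp
  then have "2 * s + 1 / t \<le> 2 * t" using st by (simp add: field_simps)
  then show ?case using Suc by (simp add: s_def t_def)
qed simp

text \<open>The roles of \<open>m\<close> and \<open>d\<close> are exchanged: for each small
  cofactor \<open>m\<close> the admissible \<open>d\<close> are square roots of a fixed class, at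
  most \<open>sqrt (x / m)\<close> in size, and \<open>square_root_count\<close> applies. This holds
  for every class \<open>a\<close> without averaging.\<close>

lemma sum_large_squares_le:
  fixes x :: real and q a N M K :: nat
  assumes "x \<ge> 0" "q > 0" "coprime a q"
    and M: "\<And>m d. N < d \<Longrightarrow> real (m * d\<^sup>2) \<le> x \<Longrightarrow> m \<le> M"
  shows "(\<Sum>d | d \<in> {N<..K} \<and> coprime d q. real (card {m. 1 \<le> m \<and> real (m * d\<^sup>2) \<le> x \<and> [m * d\<^sup>2 = a] (mod q)}))
         \<le> real (card {u. u dvd q}) * (4 * sqrt x * sqrt M / q + M)"
proof -
  define D where "D = {d. d \<in> {N<..K} \<and> coprime d q}"
  define \<tau> where "\<tau> = real (card {u. u dvd q})"
  define P where "P = (\<lambda>m d. real (m * d\<^sup>2) \<le> x \<and> [m * d\<^sup>2 = a] (mod q))"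
  have fD: "finite D" by (simp add: D_def)
  have "(\<Sum>d\<in>D. real (card {m. 1 \<le> m \<and> real (m * d\<^sup>2) \<le> x \<and> [m * d\<^sup>2 = a] (mod q)}))
      = (\<Sum>d\<in>D. \<Sum>m\<in>{1..M}. if P m d then 1 else 0)"
  proof (rule sum.cong)
    fix d assume d: "d \<in> D"
    have "{m. 1 \<le> m \<and> real (m * d\<^sup>2) \<le> x \<and> [m * d\<^sup>2 = a] (mod q)} = {m\<in>{1..M}. P m d}"
      using M[of d] d by (auto simp: P_def D_def)
    then show "real (card {m. 1 \<le> m \<and> real (m * d\<^sup>2) \<le> x \<and> [m * d\<^sup>2 = a] (mod q)})
        = (\<Sum>m\<in>{1..M}. if P m d then 1 else 0)"
      by (simp add: sum.inter_filter[symmetric])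
  qed simp
  also have "\<dots> = (\<Sum>m\<in>{1..M}. \<Sum>d\<in>D. if P m d then 1 else 0)" by (rule sum.swap)
  also have "\<dots> = (\<Sum>m\<in>{1..M}. real (card {d\<in>D. P m d}))"
    by (simp add: sum.inter_filter[symmetric] fD)
  also have "\<dots> \<le> (\<Sum>m\<in>{1..M}. \<tau> * (2 * sqrt x / q * (1 / sqrt m) + 1))"
  proof (rule sum_mono)
    fix m assume m: "m \<in> {1..M}"
    show "real (card {d\<in>D. P m d}) \<le> \<tau> * (2 * sqrt x / q * (1 / sqrt m) + 1)"
    proof (cases "{d\<in>D. P m d} = {}")
      case True
      then have "card {d\<in>D. P m d} = 0" by (simp only: card.empty)
      then show ?thesis using assms by (simp add: \<tau>_def)
    next
      \<comment> \<open>A single solution already forces \<open>m\<close> to be coprime to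
        \<open>q\<close>, as \<open>square_root_count\<close> requires.\<close>
      case False
      then obtain d0 where "[m * d0\<^sup>2 = a] (mod q)" by (auto simp: P_def)
      then have "coprime (m * d0\<^sup>2) q" using assms(3) by (metis cong_imp_coprime cong_sym)
      then have cop: "coprime m q" by simp
      define L where "L = nat \<lfloor>sqrt (x / m)\<rfloor>"
      have "{d\<in>D. P m d} \<subseteq> {d\<in>{1..L}. coprime d q \<and> [m * d\<^sup>2 = a] (mod q)}"
      proof
        fix d assume d: "d \<in> {d\<in>D. P m d}"
        then have "real m * (real d)\<^sup>2 \<le> x" by (simp add: P_def)
        then have "(real d)\<^sup>2 \<le> x / m" using m by (simp add: field_simps)
        then have "real d \<le> sqrt (x / m)" by (rule real_le_rsqrt)
        then have "d \<le> L" by (simp add: L_def le_nat_floor)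
        then show "d \<in> {d\<in>{1..L}. coprime d q \<and> [m * d\<^sup>2 = a] (mod q)}"
          using d by (auto simp: D_def P_def)
      qed
      then have "card {d\<in>D. P m d} \<le> card {d\<in>{1..L}. coprime d q \<and> [m * d\<^sup>2 = a] (mod q)}"
        by (rule card_mono[rotated]) simp
      then have "real (card {d\<in>D. P m d}) \<le> \<tau> * (2 * real L / q + 1)"
        using square_root_count[OF assms(2) cop, of L a] by (simp add: \<tau>_def)
      also have "\<dots> \<le> \<tau> * (2 * sqrt (x / m) / q + 1)"
      proof -
        have "real L \<le> sqrt (x / m)" unfolding L_def using assms(1) by (simp add: of_nat_floor)
        then show ?thesis by (intro mult_left_mono add_mono divide_right_mono) (auto simp: \<tau>_def)
      qed
      also have "\<dots> = \<tau> * (2 * sqrt x / q * (1 / sqrt m) + 1)" by (simp add: real_sqrt_divide)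
      finally show ?thesis .
    qed
  qed
  also have "\<dots> = \<tau> * (2 * sqrt x / q * (\<Sum>m\<in>{1..M}. 1 / sqrt m) + M)"
    by (simp only: sum.distrib sum_distrib_left[symmetric]) simp
  also have "\<dots> \<le> \<tau> * (2 * sqrt x / q * (2 * sqrt M) + M)"
    using sum_inverse_sqrt_le[of M] assms by (intro mult_left_mono add_mono) (auto simp: \<tau>_def)
  also have "\<dots> = \<tau> * (4 * sqrt x * sqrt M / q + M)" by simp
  finally show ?thesis by (simp add: D_def \<tau>_def)
qed

text \<open>The part of the error from \<open>d \<le> N\<close>. The subtracted average uses the
  rounded number of \<open>m\<close> instead of \<open>x / d\<^sup>2\<close>, so that it has exactly
  the shape treated by \<open>second_moment_square_classes\<close>.\<close>

definition sqf_error_main :: "real \<Rightarrow> nat \<Rightarrow> nat \<Rightarrow> nat \<Rightarrow> real" where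
  "sqf_error_main x q N a = (\<Sum>d\<in>{d\<in>{1..N}. coprime d q}. of_int (moebius_mu d) *
     (real (card {m\<in>{1..nat \<lfloor>x / (real d)\<^sup>2\<rfloor>}. [m * d\<^sup>2 = a] (mod q)}) - real (nat \<lfloor>x / (real d)\<^sup>2\<rfloor>) / q))"

text \<open>The parameter \<open>u\<close> is the fourth root of \<open>q\<close>, which keeps all
  exponents integral. Three remainders arise: rounding \<open>x / d\<^sup>2\<close>, truncating the
  density series at \<open>N\<close>, and the terms with \<open>d > N\<close>. Only the last one
  costs a divisor count.\<close>

lemma sqf_error_approx:
  fixes x u :: real and q a N :: nat
  assumes x: "x \<ge> 1" and u: "u \<ge> 1" "real q = u ^ 4" "u ^ 5 \<le> sqrt x"
    and a: "coprime a q" and N_def: "N = nat \<lfloor>sqrt x / u\<rfloor>"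
  shows "\<bar>sqf_error x q a - sqf_error_main x q N a\<bar> \<le> 8 * real (card {u. u dvd q}) * (sqrt x / u ^ 3)"
proof -
  define \<tau> where "\<tau> = real (card {u. u dvd q})"
  define Y where "Y = sqrt x / u ^ 3"
  define D where "D = {d\<in>{1..N}. coprime d q}"
  define K where "K = nat \<lfloor>x\<rfloor>"
  define n where "n = (\<lambda>d. nat \<lfloor>x / (real d)\<^sup>2\<rfloor>)"
  define b where "b = (\<lambda>d. real (card {m. 1 \<le> m \<and> real (m * d\<^sup>2) \<le> x \<and> [m * d\<^sup>2 = a] (mod q)}))"
  define \<mu> where "\<mu> = (\<lambda>d. real_of_int (moebius_mu d))"
  define E where "E = {d. d \<in> {N<..K} \<and> coprime d q}"
  have \<mu>1: "\<bar>\<mu> d\<bar> \<le> 1" for d by (simp add: \<mu>_def abs_moebius_mu_le)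
  have u0: "u > 0" using u by simp
  have q: "q > 0" using u u0 by (metis of_nat_0_less_iff zero_less_power)
  have \<tau>1: "\<tau> \<ge> 1" using card_divisors_ge_1[OF q] by (simp add: \<tau>_def)
  have "u ^ 1 \<le> u ^ 5" using u(1) by (rule power_increasing[rotated]) simp
  then have D1: "sqrt x / u \<ge> 1" using u u0 by (simp add: field_simps)
  then have N1: "N \<ge> 1" unfolding N_def by (simp add: le_nat_floor)
  have N_le: "real N \<le> sqrt x / u" unfolding N_def using D1 by (intro of_nat_floor) simp
  have N_gt: "sqrt x / u < real N + 1" unfolding N_def using D1 by linarith
  have N_half: "sqrt x / u \<le> 2 * real N" using N_gt N1 by simp
  have sx: "sqrt x \<ge> 1" "sqrt x * sqrt x = x" using x by auto
  have sx_le: "sqrt x \<le> x" using mult_left_mono[OF sx(1), of "sqrt x"] sx by simp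
  have "sqrt x / u \<le> sqrt x" using u u0 sx(1) by (simp add: field_simps)
  then have "real N \<le> x" using N_le sx_le by linarith
  then have NK: "N \<le> K" by (simp add: K_def le_nat_floor)
  have Y0: "Y \<ge> 0" using x u0 by (simp add: Y_def)
  have D_K: "{d. d \<in> {1..K} \<and> coprime d q} = D \<union> E" "D \<inter> E = {}" "finite D" "finite E"
    using NK by (auto simp: D_def E_def)

  have "sqf_sum x q a = (\<Sum>d\<in>D \<union> E. \<mu> d * b d)"
    unfolding D_K(1)[symmetric] \<mu>_def b_def
    by (rule sqf_sum_conv_moebius) (use x q a in \<open>auto simp: K_def\<close>)
  also have "\<dots> = (\<Sum>d\<in>D. \<mu> d * b d) + (\<Sum>d\<in>E. \<mu> d * b d)"
    by (rule sum.union_disjoint) (use D_K in auto)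
  finally have S: "sqf_sum x q a = (\<Sum>d\<in>D. \<mu> d * b d) + (\<Sum>d\<in>E. \<mu> d * b d)" .
  have b: "b d = real (card {m\<in>{1..n d}. [m * d\<^sup>2 = a] (mod q)})" if "d \<in> D" for d
  proof -
    have d: "d > 0" using that by (auto simp: D_def)
    have "real (m * d\<^sup>2) \<le> x \<longleftrightarrow> m \<le> n d" for m
    proof -
      have "real (m * d\<^sup>2) \<le> x \<longleftrightarrow> real m \<le> x / (real d)\<^sup>2" using d by (simp add: field_simps)
      also have "\<dots> \<longleftrightarrow> m \<le> n d" unfolding n_def using x by (simp add: le_nat_iff le_floor_iff)
      finally show ?thesis .
    qed
    then show ?thesis by (simp add: b_def)
  qed
  have A: "sqf_error_main x q N a = (\<Sum>d\<in>D. \<mu> d * (b d - real (n d) / q))"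
    unfolding sqf_error_main_def D_def[symmetric] by (rule sum.cong) (simp_all add: b n_def \<mu>_def)
  \<comment> \<open>\<open>R1\<close> is the rounding error, \<open>R2\<close> the truncation error
    of the density, \<open>R3\<close> the contribution of large \<open>d\<close>.\<close>
  define R1 where "R1 = (\<Sum>d\<in>D. \<mu> d * (real (n d) - x / (real d)\<^sup>2)) / q"
  define R2 where "R2 = x / q * (sqf_density q - (\<Sum>d\<in>D. \<mu> d / (real d)\<^sup>2))"
  define R3 where "R3 = (\<Sum>d\<in>E. \<mu> d * b d)"
  have decomp: "sqf_error x q a - sqf_error_main x q N a = R1 - R2 + R3"
  proof -
    have "(\<Sum>d\<in>D. \<mu> d * (b d - real (n d) / q)) = (\<Sum>d\<in>D. \<mu> d * b d) - (\<Sum>d\<in>D. \<mu> d * real (n d)) / q"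
      by (simp add: right_diff_distrib sum_subtractf sum_divide_distrib)
    moreover have "(\<Sum>d\<in>D. \<mu> d * (real (n d) - x / (real d)\<^sup>2))
        = (\<Sum>d\<in>D. \<mu> d * real (n d)) - x * (\<Sum>d\<in>D. \<mu> d / (real d)\<^sup>2)"
      by (simp add: right_diff_distrib sum_subtractf sum_distrib_left mult_ac)
    ultimately show ?thesis
      unfolding sqf_error_def S A R1_def R2_def R3_def using q by (simp add: field_simps)
  qed

  have R1: "\<bar>R1\<bar> \<le> Y"
  proof -
    have "\<bar>\<Sum>d\<in>D. \<mu> d * (real (n d) - x / (real d)\<^sup>2)\<bar> \<le> (\<Sum>d\<in>D. 1)"
    proof (rule order_trans[OF sum_abs], rule sum_mono)
      fix d
      have "x / (real d)\<^sup>2 \<ge> 0" using x by simp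
      then have "\<bar>real (n d) - x / (real d)\<^sup>2\<bar> \<le> 1" unfolding n_def by linarith
      then have "\<bar>\<mu> d\<bar> * \<bar>real (n d) - x / (real d)\<^sup>2\<bar> \<le> 1 * 1"
        using \<mu>1[of d] by (intro mult_mono) auto
      then show "\<bar>\<mu> d * (real (n d) - x / (real d)\<^sup>2)\<bar> \<le> 1" by (simp add: abs_mult)
    qed
    also have "\<dots> = real (card D)" by simp
    also have "\<dots> \<le> real (card {1..N})" by (intro of_nat_mono card_mono) (auto simp: D_def)
    finally have "\<bar>R1\<bar> \<le> real N / q" unfolding R1_def by (simp add: divide_right_mono)
    also have "\<dots> \<le> sqrt x / u / q" using N_le by (intro divide_right_mono) auto
    also have "\<dots> = sqrt x / u ^ 5" by (simp add: u(2) power_Suc[symmetric] eval_nat_numeral)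
    also have "\<dots> \<le> Y" unfolding Y_def using u u0 sx
      by (intro divide_left_mono power_increasing) auto
    finally show ?thesis .
  qed
  have R2: "\<bar>R2\<bar> \<le> 2 * Y"
  proof -
    have "\<bar>sqf_density q - (\<Sum>d\<in>D. \<mu> d / (real d)\<^sup>2)\<bar> \<le> 1 / N"
      using sqf_density_approx[of N q] N1 q by (simp add: D_def \<mu>_def)
    also have "\<dots> = 2 / (2 * real N)" by simp
    also have "\<dots> \<le> 2 / (sqrt x / u)"
      using N_half N1 D1 by (intro divide_left_mono mult_pos_pos) linarith+
    finally have "\<bar>sqf_density q - (\<Sum>d\<in>D. \<mu> d / (real d)\<^sup>2)\<bar> \<le> 2 / (sqrt x / u)" .
    then have "x / q * \<bar>sqf_density q - (\<Sum>d\<in>D. \<mu> d / (real d)\<^sup>2)\<bar> \<le> x / q * (2 / (sqrt x / u))"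
      using x by (intro mult_left_mono) auto
    also have "\<dots> = sqrt x * sqrt x / u ^ 4 * (2 / (sqrt x / u))" unfolding sx(2) u(2) ..
    also have "\<dots> = 2 * Y" using u0 sx(1) by (simp add: Y_def field_simps eval_nat_numeral del: real_sqrt_mult_self)
    finally show ?thesis using x unfolding R2_def by (simp add: abs_mult)
  qed
  have R3: "\<bar>R3\<bar> \<le> 5 * \<tau> * Y"
  proof -
    \<comment> \<open>For \<open>d > N\<close> one has \<open>d \<ge> sqrt x / u\<close>, hence the
      cofactor is at most \<open>x / d\<^sup>2 \<le> u\<^sup>2\<close>.\<close>
    define M where "M = nat \<lfloor>u\<^sup>2\<rfloor>"
    have M: "real M \<le> u\<^sup>2" by (simp add: M_def of_nat_floor)
    have "\<bar>R3\<bar> \<le> (\<Sum>d\<in>E. b d)" unfolding R3_def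
    proof (rule order_trans[OF sum_abs], rule sum_mono)
      fix d
      have "\<bar>\<mu> d\<bar> * \<bar>b d\<bar> \<le> 1 * b d" using \<mu>1[of d] by (intro mult_mono) (auto simp: b_def)
      then show "\<bar>\<mu> d * b d\<bar> \<le> b d" by (simp add: abs_mult)
    qed
    also have "\<dots> \<le> \<tau> * (4 * sqrt x * sqrt M / q + M)"
      unfolding E_def b_def \<tau>_def
    proof (rule sum_large_squares_le)
      fix m d :: nat assume d: "N < d" "real (m * d\<^sup>2) \<le> x"
      have "sqrt x / u \<le> real d" using N_gt d(1) by linarith
      then have "sqrt x \<le> u * real d" using u0 by (simp add: field_simps)
      then have "(sqrt x)\<^sup>2 \<le> (u * real d)\<^sup>2" using x by (intro power_mono) auto
      then have "x \<le> u\<^sup>2 * (real d)\<^sup>2" using x by (simp add: power_mult_distrib)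
      then have "real m * (real d)\<^sup>2 \<le> u\<^sup>2 * (real d)\<^sup>2" using d(2) by simp
      then have "real m \<le> u\<^sup>2" using d(1) by simp
      then show "m \<le> M" by (simp add: M_def le_nat_floor)
    qed (use x q a in auto)
    also have "\<dots> \<le> \<tau> * (4 * Y + Y)"
    proof (intro mult_left_mono add_mono)
      have "sqrt M \<le> u" using M u0 by (intro real_le_lsqrt) auto
      then have "4 * sqrt x * sqrt M / q \<le> 4 * sqrt x * u / q"
        using sx by (intro divide_right_mono mult_left_mono) auto
      also have "\<dots> = 4 * Y" using u0 by (simp add: Y_def u(2) field_simps eval_nat_numeral)
      finally show "4 * sqrt x * sqrt M / q \<le> 4 * Y" .
      \<comment> \<open>The condition \<open>u ^ 5 \<le> sqrt x\<close> makes the term with one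
        solution per cofactor no larger than \<open>Y\<close>.\<close>
      have "u\<^sup>2 * u ^ 3 \<le> sqrt x" using u(3) by (simp flip: power_add)
      then have "u\<^sup>2 \<le> Y" using u0 by (simp add: Y_def pos_le_divide_eq)
      then show "real M \<le> Y" using M by simp
    qed (use \<tau>1 in auto)
    finally show ?thesis by simp
  qed
  have "\<bar>R1 - R2 + R3\<bar> \<le> 3 * Y + 5 * \<tau> * Y" using R1 R2 R3 by linarith
  also have "3 * Y \<le> 3 * (\<tau> * Y)" using mult_right_mono[OF \<tau>1 Y0] by simp
  finally have "\<bar>R1 - R2 + R3\<bar> \<le> 8 * \<tau> * Y" by (simp add: mult_ac)
  then show ?thesis unfolding decomp \<tau>_def Y_def .
qed

text \<open>The part from \<open>d \<le> N\<close> is handled on average and the remainder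
  pointwise. The constant is \<open>2 * 3 + 128\<close>, from the second moment bound and from
  \<open>2 * 8\<^sup>2\<close>.\<close>

lemma sqf_error_second_moment:
  fixes x u :: real and q :: nat
  assumes x: "x \<ge> 1" and u: "u \<ge> 1" "real q = u ^ 4" "u ^ 5 \<le> sqrt x"
  shows "(\<Sum>a\<in>totatives q. (sqf_error x q a)\<^sup>2) \<le> 134 * (real (card {d. d dvd q}) * harm q)\<^sup>2 * (x / u\<^sup>2)"
proof -
  define \<tau> where "\<tau> = real (card {d. d dvd q})"
  define H where "H = (harm q :: real)"
  define Y where "Y = sqrt x / u ^ 3"
  define N where "N = nat \<lfloor>sqrt x / u\<rfloor>"
  define A where "A = sqf_error_main x q N"
  have u0: "u > 0" using u by simp
  have q: "q > 0" using u u0 by (metis of_nat_0_less_iff zero_less_power)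
  have \<tau>1: "\<tau> \<ge> 1" using card_divisors_ge_1[OF q] by (simp add: \<tau>_def)
  have "(harm 1 :: real) \<le> harm q" using q by (intro harm_mono) simp
  then have H1: "H \<ge> 1" by (simp add: H_def harm_expand)
  have Dpos: "sqrt x / u \<ge> 0" using x u0 by simp
  have N_le: "real N \<le> sqrt x / u" unfolding N_def using Dpos by (rule of_nat_floor)
  have "real q * u \<le> sqrt x" using u by (simp flip: power_Suc2 add: eval_nat_numeral)
  then have q_le: "real q \<le> sqrt x / u" using u0 by (simp add: pos_le_divide_eq)
  have DD: "sqrt x / u * (sqrt x / u) = x / u\<^sup>2" using x by (simp add: power2_eq_square)
  have xu: "x / u\<^sup>2 \<ge> 0" using x by simp

  \<comment> \<open>Totatives lie in \<open>{1..q}\<close> and include \<open>q\<close> itself when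
    \<open>q = 1\<close>, so they are reduced modulo \<open>q\<close> before being compared with the
    residues \<open>{..<q}\<close>.\<close>
  have "(\<Sum>a\<in>totatives q. (A a)\<^sup>2) = (\<Sum>a\<in>totatives q. (A (a mod q))\<^sup>2)"
    by (simp add: A_def sqf_error_main_def cong_def)
  also have "\<dots> = (\<Sum>a\<in>(\<lambda>a. a mod q) ` totatives q. (A a)\<^sup>2)"
  proof (subst sum.reindex)
    show "inj_on (\<lambda>a. a mod q) (totatives q)"
    proof (rule inj_onI)
      fix a b assume ab: "a \<in> totatives q" "b \<in> totatives q" "a mod q = b mod q"
      then have "0 < a" "a \<le> q" "0 < b" "b \<le> q" by (auto simp: totatives_def)
      then show "a = b" using ab(3) by (cases "a = q"; cases "b = q") auto
    qed
  qed simp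
  also have "\<dots> \<le> (\<Sum>a<q. (A a)\<^sup>2)"
    by (rule sum_mono2) (use q in auto)
  also have "\<dots> \<le> \<tau> * H\<^sup>2 * N * (2 * N + q)"
    unfolding A_def sqf_error_main_def \<tau>_def H_def
    by (rule second_moment_square_classes[OF q abs_moebius_mu_le])
  \<comment> \<open>By \<open>u ^ 5 \<le> sqrt x\<close> the modulus \<open>q\<close> is at most the
    cutoff \<open>sqrt x / u\<close>, so \<open>2 * N + q\<close> is at most three cutoffs.\<close>
  also have "\<dots> \<le> \<tau> * H\<^sup>2 * (sqrt x / u) * (3 * (sqrt x / u))"
  proof (rule mult_mono)
    show "\<tau> * H\<^sup>2 * real N \<le> \<tau> * H\<^sup>2 * (sqrt x / u)"
      using N_le \<tau>1 by (intro mult_left_mono) auto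
    show "real (2 * N + q) \<le> 3 * (sqrt x / u)" using N_le q_le by simp
    show "0 \<le> \<tau> * H\<^sup>2 * (sqrt x / u)" using Dpos \<tau>1 by (intro mult_nonneg_nonneg) auto
  qed auto
  also have "\<dots> = 3 * (\<tau> * H\<^sup>2) * (x / u\<^sup>2)" unfolding DD[symmetric] by simp
  also have "\<dots> \<le> 3 * (\<tau> * H)\<^sup>2 * (x / u\<^sup>2)"
  proof (intro mult_right_mono mult_left_mono xu)
    have "\<tau> * H\<^sup>2 \<le> \<tau>\<^sup>2 * H\<^sup>2" using \<tau>1 by (intro mult_right_mono) (auto simp: power2_eq_square)
    then show "\<tau> * H\<^sup>2 \<le> (\<tau> * H)\<^sup>2" by (simp add: power_mult_distrib)
  qed auto
  finally have A_bound: "(\<Sum>a\<in>totatives q. (A a)\<^sup>2) \<le> 3 * (\<tau> * H)\<^sup>2 * (x / u\<^sup>2)" .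

  have "(\<Sum>a\<in>totatives q. (sqf_error x q a)\<^sup>2) \<le> (\<Sum>a\<in>totatives q. 2 * (A a)\<^sup>2 + 128 * \<tau>\<^sup>2 * Y\<^sup>2)"
  proof (rule sum_mono)
    fix a assume "a \<in> totatives q"
    then have cop: "coprime a q" by (simp add: totatives_def)
    define R where "R = sqf_error x q a - A a"
    have "\<bar>R\<bar> \<le> 8 * \<tau> * Y"
      unfolding R_def A_def \<tau>_def Y_def by (rule sqf_error_approx[OF x u cop N_def])
    then have "R\<^sup>2 \<le> (8 * \<tau> * Y)\<^sup>2" by (metis abs_ge_zero power2_abs power_mono)
    then have R: "R\<^sup>2 \<le> 64 * \<tau>\<^sup>2 * Y\<^sup>2" by (simp add: power_mult_distrib)
    have "(sqf_error x q a)\<^sup>2 = (A a + R)\<^sup>2" by (simp add: R_def)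
    also have "\<dots> \<le> 2 * (A a)\<^sup>2 + 2 * R\<^sup>2"
      using zero_le_power2[of "A a - R"] by (simp add: power2_eq_square algebra_simps)
    finally show "(sqf_error x q a)\<^sup>2 \<le> 2 * (A a)\<^sup>2 + 128 * \<tau>\<^sup>2 * Y\<^sup>2" using R by linarith
  qed
  also have "\<dots> = 2 * (\<Sum>a\<in>totatives q. (A a)\<^sup>2) + 128 * \<tau>\<^sup>2 * (totient q * Y\<^sup>2)"
    by (simp add: sum.distrib sum_distrib_left totient_def)
  also have "\<dots> \<le> 2 * (\<Sum>a\<in>totatives q. (A a)\<^sup>2) + 128 * \<tau>\<^sup>2 * (x / u\<^sup>2)"
  proof (intro add_left_mono mult_left_mono)
    have "totient q * Y\<^sup>2 \<le> q * Y\<^sup>2" using totient_le[of q] by (intro mult_right_mono) auto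
    \<comment> \<open>Summed over all classes the squared remainder has the same size as the
      averaged part, which is why the cutoff is \<open>sqrt x / u\<close>.\<close>
    also have "\<dots> = x / u\<^sup>2"
      using x u0 by (simp add: Y_def u(2) power_divide field_simps eval_nat_numeral)
    finally show "totient q * Y\<^sup>2 \<le> x / u\<^sup>2" .
  qed auto
  also have "\<dots> \<le> 2 * (3 * (\<tau> * H)\<^sup>2 * (x / u\<^sup>2)) + 128 * (\<tau> * H)\<^sup>2 * (x / u\<^sup>2)"
  proof (intro add_mono mult_left_mono mult_right_mono A_bound xu)
    have "\<tau>\<^sup>2 * 1 \<le> \<tau>\<^sup>2 * H\<^sup>2" using H1 by (intro mult_left_mono) auto
    then show "\<tau>\<^sup>2 \<le> (\<tau> * H)\<^sup>2" by (simp add: power_mult_distrib)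
  qed auto
  also have "\<dots> = 134 * (\<tau> * H)\<^sup>2 * (x / u\<^sup>2)" by simp
  finally show ?thesis by (simp add: \<tau>_def H_def)
qed

section \<open>Harmonic numbers and the conclusion by Chebyshev's inequality\<close>

lemma harm_le_powr:
  fixes \<delta> :: real
  assumes "\<delta> > 0" "n > 0"
  shows "harm n \<le> (1 + 1 / \<delta>) * real n powr \<delta>"
proof -
  obtain k where k: "n = Suc k" using assms(2) by (cases n) auto
  \<comment> \<open>The difference \<open>harm n - ln n\<close> decreases to Euler's constant, so
    its value \<open>1\<close> at \<open>n = 1\<close> is an upper bound.\<close>
  have "harm (Suc k) - ln (real (Suc k)) \<le> harm (Suc 0) - ln (real (Suc 0))"
    using decseqD[OF decseq_harm_diff_ln, of 0 k] by simp
  then have "harm n \<le> 1 + ln (real n)" by (simp add: k harm_expand)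
  also have "ln (real n) \<le> real n powr \<delta> / \<delta>" using assms by (intro ln_powr_bound) auto
  also have "1 \<le> real n powr \<delta>" using assms by (intro ge_one_powr_ge_zero) auto
  finally show ?thesis by (simp add: distrib_right)
qed

theorem corollary4:
  fixes \<epsilon> :: real
  assumes "\<epsilon> > 0"
  shows "\<exists>C>0. \<forall>(x::real) (q::nat).
    x \<ge> 1 \<longrightarrow> q \<ge> 1 \<longrightarrow> x powr (1/4) \<le> real q \<longrightarrow> real q \<le> x powr (1/3) \<longrightarrow>
    \<bar>1 / real (totient q) *
      real (card {a \<in> totatives q. \<bar>sqf_error x q a\<bar> > x powr (1/4 + \<epsilon>) * real q powr (1/4)})\<bar>
    \<le> C * (x powr (1/2 - \<epsilon>) / real q ^ 2)"
proof -
  \<comment> \<open>Five factors of size \<open>q powr \<delta>\<close> will occur: two divisor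
    counts and two harmonic numbers from the second moment, and one divisor count from
    \<open>q / totient q\<close>.\<close>
  define \<delta> where "\<delta> = \<epsilon> / 5"
  have \<delta>: "\<delta> > 0" using assms by (simp add: \<delta>_def)
  obtain C1 where C1: "C1 > 0" "\<And>n. n > 0 \<Longrightarrow> real (card {d. d dvd n}) \<le> C1 * real n powr \<delta>"
    using divisor_bound[OF \<delta>] by blast
  define C2 where "C2 = 1 + 1 / \<delta>"
  have C2: "C2 > 0" using \<delta> by (simp add: C2_def add_pos_pos)
  define C where "C = 134 * C1 ^ 3 * C2\<^sup>2"
  show ?thesis
  proof (intro exI[of _ C] conjI allI impI)
    show "C > 0" using C1 C2 by (simp add: C_def)
    fix x :: real and q :: nat
    assume x: "x \<ge> 1" and q1: "q \<ge> 1" and qx: "real q \<le> x powr (1/3)"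
    have q: "q > 0" using q1 by simp
    define u where "u = real q powr (1/4)"
    define \<tau> where "\<tau> = real (card {d. d dvd q})"
    define H where "H = (harm q :: real)"
    define B where "B = {a \<in> totatives q. \<bar>sqf_error x q a\<bar> > x powr (1/4 + \<epsilon>) * real q powr (1/4)}"
    have u1: "u \<ge> 1" unfolding u_def using q by (intro ge_one_powr_ge_zero) auto
    have u4: "real q = u ^ 4" using q by (simp add: u_def powr_powr flip: powr_realpow)
    have u2: "u\<^sup>2 = real q powr (1/2)" using q by (simp add: u_def powr_powr flip: powr_realpow)
    \<comment> \<open>From \<open>q \<le> x powr (1/3)\<close> the left side is at most
      \<open>x powr (5/12)\<close>.\<close>
    have u5: "u ^ 5 \<le> sqrt x"
    proof -
      have "u ^ 5 = real q powr (5/4)" using q by (simp add: u_def powr_powr flip: powr_realpow)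
      also have "\<dots> \<le> (x powr (1/3)) powr (5/4)" using qx by (intro powr_mono2) auto
      also have "\<dots> = x powr (5/12)" by (simp add: powr_powr)
      also have "\<dots> \<le> x powr (1/2)" using x by (intro powr_mono) auto
      also have "\<dots> = sqrt x" using x by (simp add: powr_half_sqrt)
      finally show ?thesis .
    qed
    have \<tau>0: "\<tau> \<ge> 0" by (simp add: \<tau>_def)
    have H0: "H \<ge> 0" by (simp add: H_def harm_nonneg)
    have fB: "finite B" by (simp add: B_def)
    have thr: "(x powr (1/4 + \<epsilon>) * u)\<^sup>2 = x powr (1/2 + 2 * \<epsilon>) * u\<^sup>2"
    proof -
      have "(x powr (1/4 + \<epsilon>))\<^sup>2 = x powr (1/2 + 2 * \<epsilon>)"
        using x by (simp add: power2_eq_square algebra_simps flip: powr_add)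
      then show ?thesis by (simp add: power_mult_distrib)
    qed
    \<comment> \<open>Chebyshev: each exceptional class contributes at least the squared threshold
      to the second moment.\<close>
    have "real (card B) * (x powr (1/2 + 2 * \<epsilon>) * u\<^sup>2) = (\<Sum>a\<in>B. (x powr (1/4 + \<epsilon>) * u)\<^sup>2)"
      unfolding thr by simp
    also have "\<dots> \<le> (\<Sum>a\<in>B. (sqf_error x q a)\<^sup>2)"
    proof (rule sum_mono)
      fix a assume "a \<in> B"
      then have "x powr (1/4 + \<epsilon>) * u \<le> \<bar>sqf_error x q a\<bar>" by (simp add: B_def u_def)
      then have "(x powr (1/4 + \<epsilon>) * u)\<^sup>2 \<le> \<bar>sqf_error x q a\<bar>\<^sup>2" using u1 by (intro power_mono) auto
      then show "(x powr (1/4 + \<epsilon>) * u)\<^sup>2 \<le> (sqf_error x q a)\<^sup>2" by simp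
    qed
    also have "\<dots> \<le> (\<Sum>a\<in>totatives q. (sqf_error x q a)\<^sup>2)"
      by (rule sum_mono2) (auto simp: B_def)
    also have "\<dots> \<le> 134 * (\<tau> * H)\<^sup>2 * (x / u\<^sup>2)"
      unfolding \<tau>_def H_def by (rule sqf_error_second_moment[OF x u1 u4 u5])
    finally have "real (card B) * (x powr (1/2 + 2 * \<epsilon>) * u\<^sup>2) \<le> 134 * (\<tau> * H)\<^sup>2 * (x / u\<^sup>2)" .
    then have "real (card B) \<le> 134 * (\<tau> * H)\<^sup>2 * (x / u\<^sup>2) / (x powr (1/2 + 2 * \<epsilon>) * u\<^sup>2)"
      using x u1 by (subst pos_le_divide_eq) auto
    also have "\<dots> = 134 * (\<tau> * H)\<^sup>2 * (x / x powr (1/2 + 2 * \<epsilon>)) / (u\<^sup>2 * u\<^sup>2)" by simp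
    also have "x / x powr (1/2 + 2 * \<epsilon>) = x powr (1 - (1/2 + 2 * \<epsilon>))"
      using x by (subst powr_diff) simp
    also have "u\<^sup>2 * u\<^sup>2 = real q" by (simp add: u4 flip: power_add)
    finally have card_B: "real (card B) \<le> 134 * (\<tau> * H)\<^sup>2 * x powr (1/2 - 2 * \<epsilon>) / q" by simp

    have "real q \<le> \<tau> * real (totient q)"
      using le_divisors_totient[OF q] unfolding \<tau>_def by (metis of_nat_le_iff of_nat_mult)
    then have "1 / real (totient q) \<le> \<tau> / q" using q by (simp add: field_simps)
    then have "1 / real (totient q) * real (card B)
        \<le> \<tau> / q * (134 * (\<tau> * H)\<^sup>2 * x powr (1/2 - 2 * \<epsilon>) / q)"
      using card_B \<tau>0 by (intro mult_mono) auto
    also have "\<dots> = 134 * (\<tau> ^ 3 * H\<^sup>2) * x powr (1/2 - 2 * \<epsilon>) / real q ^ 2"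
      by (simp add: power_mult_distrib power2_eq_square power3_eq_cube)
    \<comment> \<open>Squaring the threshold saved \<open>x powr (2 * \<epsilon>)\<close>; half of
      this saving absorbs the divisor counts and harmonic numbers.\<close>
    also have "\<dots> \<le> 134 * (C1 ^ 3 * C2\<^sup>2 * x powr \<epsilon>) * x powr (1/2 - 2 * \<epsilon>) / real q ^ 2"
    proof (intro divide_right_mono mult_right_mono mult_left_mono)
      have "\<tau> ^ 3 * H\<^sup>2 \<le> (C1 * real q powr \<delta>) ^ 3 * (C2 * real q powr \<delta>)\<^sup>2"
        using C1(2)[OF q] harm_le_powr[OF \<delta> q] \<tau>0 H0
        by (intro mult_mono power_mono) (auto simp: \<tau>_def H_def C2_def)
      also have "\<dots> = C1 ^ 3 * C2\<^sup>2 * (real q powr \<delta>) ^ 5"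
        by (simp add: power_mult_distrib mult_ac flip: power_add)
      also have "(real q powr \<delta>) ^ 5 = real q powr \<epsilon>"
        using q by (simp add: powr_powr \<delta>_def flip: powr_realpow)
      also have "real q powr \<epsilon> \<le> x powr \<epsilon>"
      proof (intro powr_mono2)
        have "x powr (1/3) \<le> x powr 1" using x by (intro powr_mono) auto
        then show "real q \<le> x" using qx x by simp
      qed (use assms in auto)
      finally show "\<tau> ^ 3 * H\<^sup>2 \<le> C1 ^ 3 * C2\<^sup>2 * x powr \<epsilon>"
        using C1 C2 by (simp add: mult_left_mono)
    qed auto
    also have "\<dots> = C * (x powr \<epsilon> * x powr (1/2 - 2 * \<epsilon>) / real q ^ 2)" by (simp add: C_def)
    also have "x powr \<epsilon> * x powr (1/2 - 2 * \<epsilon>) = x powr (1/2 - \<epsilon>)"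
      by (simp flip: powr_add)
    finally show "\<bar>1 / real (totient q) *
      real (card {a \<in> totatives q. \<bar>sqf_error x q a\<bar> > x powr (1/4 + \<epsilon>) * real q powr (1/4)})\<bar>
      \<le> C * (x powr (1/2 - \<epsilon>) / real q ^ 2)"
      by (simp add: B_def)
  qed
qed

end
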